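(* Let $R\in\mathbb R^{2\times2}$ be symmetric, $\mathbf r\in\mathbb R^2$, $p\in\mathbb R$. Then $q_{R,\mathbf r,p}\in\mathcal N(F)$ if and only if there exist $t_1,\dots,t_{19}\in\mathbb R$ such that $\Lambda_1,\dots,\Lambda_6\succeq0$. Equivalently, $q_{R,\mathbf r,p}\in\mathcal N(F)$ if and only if there exist $t_1,\dots,t_{19}\in\mathbb R$ such that $\Lambda_1,\ldots,\Lambda_6\succeq0$ and the following polynomial identity in $\mathbf x=(x_1,x_2)$ holds: $$\begin{aligned} q_{R,\mathbf r,p}(\mathbf x)=&\begin{pmatrix} 1 \\ \mathbf x \end{pmatrix}^{\top}\Lambda_1\begin{pmatrix} 1 \\ \mathbf x \end{pmatrix}+x_1\begin{pmatrix} 1 \\ x_2 \end{pmatrix}^{\top}\Lambda_2\begin{pmatrix} 1 \\ x_2 \end{pmatrix}+x_2(1-x_1x_2)\begin{pmatrix} 0 \\ 1 \end{pmatrix}^{\top}\Lambda_2\begin{pmatrix} 0 \\ 1 \end{pmatrix} \\ &+x_2\begin{pmatrix} 1 \\ x_1 \end{pmatrix}^{\top}\Lambda_3\begin{pmatrix} 1 \\ x_1 \end{pmatrix}+x_1x_2\begin{pmatrix} x_1 \\ 1 \\ 0 \end{pmatrix}^{\top}\Lambda_4\begin{pmatrix} x_1 \\ 1 \\ 0 \end{pmatrix}+(1-x_1x_2)\begin{pmatrix} x_1 \\ 0 \\ 1 \end{pmatrix}^{\top}\Lambda_4\begin{pmatrix} x_1 \\ 0 \\ 1 \end{pmatrix}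 \\ &+x_1\begin{pmatrix} 1 \\ x_2 \end{pmatrix}^{\top}\Lambda_5\begin{pmatrix} 1 \\ x_2 \end{pmatrix}+x_1x_2\begin{pmatrix} x_2 \\ 1 \\ 0 \end{pmatrix}^{\top}\Lambda_6\begin{pmatrix} x_2 \\ 1 \\ 0 \end{pmatrix}+(1-x_1x_2)\begin{pmatrix} x_2 \\ 0 \\ 1 \end{pmatrix}^{\top}\Lambda_6\begin{pmatrix} x_2 \\ 0 \\ 1 \end{pmatrix}.\end{aligned}$$
   Context: Let $F:=\{(x_1,x_2)\in\mathbb R^2 : x_1\ge 0,\ x_2\ge 0,\ x_1x_2\le 1\}$. For symmetric $R\in\mathbb R^{2\times 2}$, $\mathbf r=(r_1,r_2)\in\mathbb R^2$, $p\in\mathbb R$, let $q_{R,\mathbf r,p}(\mathbf x):=\mathbf x^\top R\mathbf x+2\mathbf r^\top\mathbf x+p$. $\mathcal N(F)$ is the cone of all $q_{R,\mathbf r,p}$ (identified with the coefficient matrix $\begin{pmatrix} p & \mathbf r^\top \\ \mathbf r & R \end{pmatrix}$) that are nonnegative on $F$. $M\succeq0$ means that the symmetric matrix $M$ is positive semidefinite. Given $(R,\mathbf r,p)$ and $t_1,\dots,t_{19}\in\mathbb R$, define the symmetric matrices $\Lambda_1,\dots,\Lambda_6$ as follows. $\Lambda_1$ is the symmetric $3\times3$ matrix $$\Lambda_1:=\begin{pmatrix} p-t_{11}-t_{19} & a & b \\ a & R_{11}-t_6 & c \\ b & c & R_{22}-t_{14} \end{pmatrix},$$ with $a:=r_1-\tfrac{t_1}{2}-t_8-\tfrac{t_{12}}{2}$,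 $b:=r_2-\tfrac{t_3}{2}-\tfrac{t_4}{2}-t_{16}$, $c:=R_{12}-t_2-t_5-t_{13}-\tfrac12(t_9-t_{11}+t_{17}-t_{19})$, and $$\Lambda_2:=\begin{pmatrix} t_1 & t_2 \\ t_2 & t_3 \end{pmatrix},\quad \Lambda_3:=\begin{pmatrix} t_4 & t_5 \\ t_5 & 2(t_8-t_7) \end{pmatrix},\quad \Lambda_4:=\begin{pmatrix} t_6 & t_7 & t_8 \\ t_7 & t_9 & t_{10} \\ t_8 & t_{10} & t_{11} \end{pmatrix},$$ $$\Lambda_5:=\begin{pmatrix} t_{12} & t_{13} \\ t_{13} & 2(t_{16}-t_{15}) \end{pmatrix},\quad \Lambda_6:=\begin{pmatrix} t_{14} & t_{15} & t_{16} \\ t_{15} & t_{17} & t_{18} \\ t_{16} & t_{18} & t_{19} \end{pmatrix}.$$ *)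

theory Defs
  imports "HOL-Analysis.Analysis"
begin

definition quad_form :: "real^'n^'n \<Rightarrow> real^'n \<Rightarrow> real" where
  "quad_form M v = v \<bullet> (M *v v)"

definition psd :: "real^'n^'n \<Rightarrow> bool" where
  "psd M \<longleftrightarrow> transpose M = M \<and> (\<forall>v. quad_form M v \<ge> 0)"

definition F :: "(real^2) set" where
  "F = {x. x $ 1 \<ge> 0 \<and> x $ 2 \<ge> 0 \<and> x $ 1 * x $ 2 \<le> 1}"

definition q :: "real^2^2 \<Rightarrow> real^2 \<Rightarrow> real \<Rightarrow> real^2 \<Rightarrow> real" where
  "q R r p x = quad_form R x + 2 * (r \<bullet> x) + p"

text \<open>Quadratics are represented by the functions they induce on the plane; by
  \<open>q_inject\<close> below, this is the same as representing them by their symmetric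
  coefficient matrices.\<close>

definition nonneg_cone :: "(real^2) set \<Rightarrow> (real^2 \<Rightarrow> real) set" where
  "nonneg_cone S = {q R r p | R r p. transpose R = R \<and> (\<forall>x\<in>S. q R r p x \<ge> 0)}"

lemma q_inject:
  assumes "transpose R = R" "transpose R' = R'"
  shows "q R r p = q R' r' p' \<longleftrightarrow> R = R' \<and> r = r' \<and> p = p'"
proof
  assume eq: "q R r p = q R' r' p'"
  have sym: "R $ 2 $ 1 = R $ 1 $ 2" "R' $ 2 $ 1 = R' $ 1 $ 2"
    using assms by (simp_all add: transpose_def vec_eq_iff)
  have expand: "q R r p (vector [x, y]) =
      R$1$1 * x\<^sup>2 + (R$1$2 + R$2$1) * x * y + R$2$2 * y\<^sup>2 + 2 * (r$1 * x + r$2 * y) + p"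
    for R r p x y
    by (simp add: q_def quad_form_def inner_vec_def matrix_vector_mult_def sum_2
        algebra_simps power2_eq_square)
  have ev: "q R r p (vector [x, y]) = q R' r' p' (vector [x, y])" for x y
    using eq by simp
  note e = ev[unfolded expand sym]
  show "R = R' \<and> r = r' \<and> p = p'"
    using e[of 0 0] e[of 1 0] e[of "-1" 0] e[of 0 1] e[of 0 "-1"] e[of 1 1] sym
    by (simp add: vec_eq_iff forall_2)
qed simp

text \<open>The parameters $t_1, \dots, t_{19}$ are the values of \<open>t\<close> at the indices
  1 to 19; its other values are never used.\<close>

definition Lambda1 :: "real^2^2 \<Rightarrow> real^2 \<Rightarrow> real \<Rightarrow> (nat \<Rightarrow> real) \<Rightarrow> real^3^3" where
  "Lambda1 R r p t =
    (let a = r $ 1 - t 1 / 2 - t 8 - t 12 / 2;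
         b = r $ 2 - t 3 / 2 - t 4 / 2 - t 16;
         c = R $ 1 $ 2 - t 2 - t 5 - t 13 - 1 / 2 * (t 9 - t 11 + t 17 - t 19)
     in vector [vector [p - t 11 - t 19, a, b],
                vector [a, R $ 1 $ 1 - t 6, c],
                vector [b, c, R $ 2 $ 2 - t 14]])"

definition Lambda2 :: "(nat \<Rightarrow> real) \<Rightarrow> real^2^2" where
  "Lambda2 t = vector [vector [t 1, t 2], vector [t 2, t 3]]"

definition Lambda3 :: "(nat \<Rightarrow> real) \<Rightarrow> real^2^2" where
  "Lambda3 t = vector [vector [t 4, t 5], vector [t 5, 2 * (t 8 - t 7)]]"

definition Lambda4 :: "(nat \<Rightarrow> real) \<Rightarrow> real^3^3" where
  "Lambda4 t = vector [vector [t 6, t 7, t 8], vector [t 7, t 9, t 10], vector [t 8, t 10, t 11]]"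

definition Lambda5 :: "(nat \<Rightarrow> real) \<Rightarrow> real^2^2" where
  "Lambda5 t = vector [vector [t 12, t 13], vector [t 13, 2 * (t 16 - t 15)]]"

definition Lambda6 :: "(nat \<Rightarrow> real) \<Rightarrow> real^3^3" where
  "Lambda6 t =
    vector [vector [t 14, t 15, t 16], vector [t 15, t 17, t 18], vector [t 16, t 18, t 19]]"

definition all_psd :: "real^2^2 \<Rightarrow> real^2 \<Rightarrow> real \<Rightarrow> (nat \<Rightarrow> real) \<Rightarrow> bool" where
  "all_psd R r p t \<longleftrightarrow> psd (Lambda1 R r p t) \<and> psd (Lambda2 t) \<and> psd (Lambda3 t) \<and>
     psd (Lambda4 t) \<and> psd (Lambda5 t) \<and> psd (Lambda6 t)"

definition certificate :: "real^2^2 \<Rightarrow> real^2 \<Rightarrow> real \<Rightarrow> (nat \<Rightarrow> real) \<Rightarrow> real^2 \<Rightarrow> real" where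
  "certificate R r p t x =
    (let x1 = x $ 1; x2 = x $ 2 in
       quad_form (Lambda1 R r p t) (vector [1, x1, x2])
     + x1 * quad_form (Lambda2 t) (vector [1, x2])
     + x2 * (1 - x1 * x2) * quad_form (Lambda2 t) (vector [0, 1])
     + x2 * quad_form (Lambda3 t) (vector [1, x1])
     + x1 * x2 * quad_form (Lambda4 t) (vector [x1, 1, 0])
     + (1 - x1 * x2) * quad_form (Lambda4 t) (vector [x1, 0, 1])
     + x1 * quad_form (Lambda5 t) (vector [1, x2])
     + x1 * x2 * quad_form (Lambda6 t) (vector [x2, 1, 0])
     + (1 - x1 * x2) * quad_form (Lambda6 t) (vector [x2, 0, 1]))"

end

theory Submission
  imports Defs
begin

text \<open>The certificate is an identity in the parameters, so positive semidefiniteness gives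
  nonnegativity on the region. For the converse, the coefficient vectors that admit a certificate
  form a closed convex cone, and it suffices to show that every linear functional that is
  nonnegative on this cone is nonnegative on the quadratics that are nonnegative on the region.
  Such a functional assigns values \<open>X, Z, W, x, y, Y\<close> to the monomials \<open>x\<^sub>1\<^sup>2, x\<^sub>1 x\<^sub>2, x\<^sub>2\<^sup>2, x\<^sub>1, x\<^sub>2, 1\<close>;
  after a perturbation one may take \<open>Y = 1\<close>. It is then the expectation over two points of the region,
  plus nonnegative multiples of the coefficients of \<open>x\<^sub>1\<^sup>2\<close> and \<open>x\<^sub>2\<^sup>2\<close>, which are nonnegative because
  the region contains both half-axes. For \<open>Z < x y\<close> both points lie on the hyperbola \<open>x\<^sub>1 x\<^sub>2 = Z\<close>;
  for \<open>Z > x y\<close> one of them lies on a coordinate axis, and the multiplier matrices \<open>\<Lambda>\<^sub>3, \<dots>, \<Lambda>\<^sub>6\<close> supply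
  the bounds on \<open>X\<close> and \<open>W\<close> that keep the other one inside the region.\<close>

section \<open>Scalar form of the certificate\<close>

definition psd2 :: "real \<Rightarrow> real \<Rightarrow> real \<Rightarrow> bool" where
  "psd2 a b c \<longleftrightarrow> (\<forall>u v. 0 \<le> a * u\<^sup>2 + 2 * b * u * v + c * v\<^sup>2)"

text \<open>The arguments are the upper triangle of a symmetric matrix read row by row, here (a, b,
  c), (d, e), (f).\<close>

definition psd3 :: "real \<Rightarrow> real \<Rightarrow> real \<Rightarrow> real \<Rightarrow> real \<Rightarrow> real \<Rightarrow> bool" where
  "psd3 a b c d e f \<longleftrightarrow>
    (\<forall>u v w. 0 \<le> a * u\<^sup>2 + d * v\<^sup>2 + f * w\<^sup>2 + 2 * b * u * v + 2 * c * u * w + 2 * e * v * w)"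

lemma quad_form_2:
  "quad_form (vector [vector [a, b], vector [b, c]] :: real^2^2) v = a * (v$1)\<^sup>2 + 2 * b * v$1 * v$2 + c * (v$2)\<^sup>2"
  by (simp add: quad_form_def inner_vec_def matrix_vector_mult_def sum_2 algebra_simps power2_eq_square)

lemma quad_form_3:
  "quad_form (vector [vector [a, b, c], vector [b, d, e], vector [c, e, f]] :: real^3^3) v =
    a * (v$1)\<^sup>2 + d * (v$2)\<^sup>2 + f * (v$3)\<^sup>2 + 2 * b * v$1 * v$2 + 2 * c * v$1 * v$3 + 2 * e * v$2 * v$3"
  by (simp add: quad_form_def inner_vec_def matrix_vector_mult_def sum_3 algebra_simps power2_eq_square)

lemma psd_iff_psd2: "psd (vector [vector [a, b], vector [b, c]] :: real^2^2) \<longleftrightarrow> psd2 a b c"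
proof -
  have "transpose (vector [vector [a, b], vector [b, c]] :: real^2^2) = vector [vector [a, b], vector [b, c]]"
    by (simp add: transpose_def vec_eq_iff forall_2)
  moreover have "(\<forall>v::real^2. P (v$1) (v$2)) \<longleftrightarrow> (\<forall>u v. P u v)" for P
    by (metis vector_2)
  ultimately show ?thesis
    unfolding psd_def psd2_def quad_form_2 by simp
qed

lemma psd_iff_psd3:
  "psd (vector [vector [a, b, c], vector [b, d, e], vector [c, e, f]] :: real^3^3) \<longleftrightarrow> psd3 a b c d e f"
proof -
  have "transpose (vector [vector [a, b, c], vector [b, d, e], vector [c, e, f]] :: real^3^3) =
      vector [vector [a, b, c], vector [b, d, e], vector [c, e, f]]"
    by (simp add: transpose_def vec_eq_iff forall_3)
  moreover have "(\<forall>v::real^3. P (v$1) (v$2) (v$3)) \<longleftrightarrow> (\<forall>u v w. P u v w)" for P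
    by (metis vector_3)
  ultimately show ?thesis
    unfolding psd_def psd3_def quad_form_3 by simp
qed

section \<open>Elementary properties of the semidefinite cones in dimensions 2 and 3\<close>

lemma psd2_zero: "psd2 0 0 0"
  by (simp add: psd2_def)

lemma psd3_zero: "psd3 0 0 0 0 0 0"
  by (simp add: psd3_def)

lemma psd2_rank_one:
  assumes "0 \<le> k"
  shows "psd2 (k * u\<^sup>2) (k * (u * v)) (k * v\<^sup>2)"
  unfolding psd2_def
proof (intro allI)
  fix r s :: real
  have "0 \<le> k * (u * r + v * s)\<^sup>2" using assms by simp
  then show "0 \<le> k * u\<^sup>2 * r\<^sup>2 + 2 * (k * (u * v)) * r * s + k * v\<^sup>2 * s\<^sup>2"
    by (simp add: power2_eq_square algebra_simps)
qed

lemma psd3_rank_one: "psd3 (u\<^sup>2) (u * v) (u * w) (v\<^sup>2) (v * w) (w\<^sup>2)"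
  unfolding psd3_def
proof (intro allI)
  fix r s t :: real
  have "0 \<le> (u * r + v * s + w * t)\<^sup>2" by simp
  then show "0 \<le> u\<^sup>2 * r\<^sup>2 + v\<^sup>2 * s\<^sup>2 + w\<^sup>2 * t\<^sup>2 + 2 * (u * v) * r * s + 2 * (u * w) * r * t + 2 * (v * w) * s * t"
    by (simp add: power2_eq_square algebra_simps)
qed

lemma psd2_scale: "0 \<le> k \<Longrightarrow> psd2 a b c \<Longrightarrow> psd2 (k * a) (k * b) (k * c)"
  unfolding psd2_def
proof (intro allI)
  fix u v assume k: "0 \<le> k" and "\<forall>u v. 0 \<le> a * u\<^sup>2 + 2 * b * u * v + c * v\<^sup>2"
  then have "0 \<le> k * (a * u\<^sup>2 + 2 * b * u * v + c * v\<^sup>2)" by simp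
  then show "0 \<le> k * a * u\<^sup>2 + 2 * (k * b) * u * v + k * c * v\<^sup>2" by (simp add: algebra_simps)
qed

lemma psd3_scale:
  "0 \<le> k \<Longrightarrow> psd3 a b c d e f \<Longrightarrow> psd3 (k * a) (k * b) (k * c) (k * d) (k * e) (k * f)"
  unfolding psd3_def
proof (intro allI)
  fix u v w assume k: "0 \<le> k" and
    "\<forall>u v w. 0 \<le> a * u\<^sup>2 + d * v\<^sup>2 + f * w\<^sup>2 + 2 * b * u * v + 2 * c * u * w + 2 * e * v * w"
  then have "0 \<le> k * (a * u\<^sup>2 + d * v\<^sup>2 + f * w\<^sup>2 + 2 * b * u * v + 2 * c * u * w + 2 * e * v * w)" by simp
  then show "0 \<le> k * a * u\<^sup>2 + k * d * v\<^sup>2 + k * f * w\<^sup>2 + 2 * (k * b) * u * v + 2 * (k * c) * u * w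
      + 2 * (k * e) * v * w"
    by (simp add: algebra_simps)
qed

lemma psd2_add: "psd2 a b c \<Longrightarrow> psd2 a' b' c' \<Longrightarrow> psd2 (a + a') (b + b') (c + c')"
  unfolding psd2_def
proof (intro allI)
  fix u v :: real
  assume "\<forall>u v. 0 \<le> a * u\<^sup>2 + 2 * b * u * v + c * v\<^sup>2" "\<forall>u v. 0 \<le> a' * u\<^sup>2 + 2 * b' * u * v + c' * v\<^sup>2"
  then have "0 \<le> (a * u\<^sup>2 + 2 * b * u * v + c * v\<^sup>2) + (a' * u\<^sup>2 + 2 * b' * u * v + c' * v\<^sup>2)" by simp
  then show "0 \<le> (a + a') * u\<^sup>2 + 2 * (b + b') * u * v + (c + c') * v\<^sup>2" by (simp add: algebra_simps)
qed

lemma psd3_add: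
  "psd3 a b c d e f \<Longrightarrow> psd3 a' b' c' d' e' f' \<Longrightarrow>
    psd3 (a + a') (b + b') (c + c') (d + d') (e + e') (f + f')"
  unfolding psd3_def
proof (intro allI)
  fix u v w :: real
  assume "\<forall>u v w. 0 \<le> a * u\<^sup>2 + d * v\<^sup>2 + f * w\<^sup>2 + 2 * b * u * v + 2 * c * u * w + 2 * e * v * w"
    "\<forall>u v w. 0 \<le> a' * u\<^sup>2 + d' * v\<^sup>2 + f' * w\<^sup>2 + 2 * b' * u * v + 2 * c' * u * w + 2 * e' * v * w"
  then have "0 \<le> (a * u\<^sup>2 + d * v\<^sup>2 + f * w\<^sup>2 + 2 * b * u * v + 2 * c * u * w + 2 * e * v * w)
      + (a' * u\<^sup>2 + d' * v\<^sup>2 + f' * w\<^sup>2 + 2 * b' * u * v + 2 * c' * u * w + 2 * e' * v * w)" by simp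
  then show "0 \<le> (a + a') * u\<^sup>2 + (d + d') * v\<^sup>2 + (f + f') * w\<^sup>2 + 2 * (b + b') * u * v
      + 2 * (c + c') * u * w + 2 * (e + e') * v * w" by (simp add: algebra_simps)
qed

lemma psd2_det:
  assumes "psd2 a b c" "0 < a"
  shows "b\<^sup>2 \<le> a * c"
proof -
  \<comment> \<open>On the test vector (-b, a) the form equals \<open>a\<close> times the
    determinant.\<close>
  have "0 \<le> a * (- b)\<^sup>2 + 2 * b * (- b) * a + c * a\<^sup>2"
    using assms(1) unfolding psd2_def by blast
  then have "0 \<le> a * (a * c - b\<^sup>2)"
    by (simp add: power2_eq_square algebra_simps)
  then show ?thesis using assms(2) by (simp add: zero_le_mult_iff)
qed

lemma tendsto_psd2:
  assumes "\<forall>n. psd2 (a n) (b n) (c n)" "a \<longlonglongrightarrow> a'" "b \<longlonglongrightarrow> b'" "c \<longlonglongrightarrow> c'"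
  shows "psd2 a' b' c'"
  unfolding psd2_def
proof (intro allI)
  fix u v
  have "(\<lambda>n. a n * u\<^sup>2 + 2 * b n * u * v + c n * v\<^sup>2) \<longlonglongrightarrow> a' * u\<^sup>2 + 2 * b' * u * v + c' * v\<^sup>2"
    by (intro tendsto_intros assms)
  then show "0 \<le> a' * u\<^sup>2 + 2 * b' * u * v + c' * v\<^sup>2"
    by (rule LIMSEQ_le_const) (use assms(1) in \<open>auto simp: psd2_def\<close>)
qed

lemma tendsto_psd3:
  assumes "\<forall>n. psd3 (a n) (b n) (c n) (d n) (e n) (f n)" "a \<longlonglongrightarrow> a'" "b \<longlonglongrightarrow> b'" "c \<longlonglongrightarrow> c'"
    "d \<longlonglongrightarrow> d'" "e \<longlonglongrightarrow> e'" "f \<longlonglongrightarrow> f'"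
  shows "psd3 a' b' c' d' e' f'"
  unfolding psd3_def
proof (intro allI)
  fix u v w
  have "(\<lambda>n. a n * u\<^sup>2 + d n * v\<^sup>2 + f n * w\<^sup>2 + 2 * b n * u * v + 2 * c n * u * w + 2 * e n * v * w)
      \<longlonglongrightarrow> a' * u\<^sup>2 + d' * v\<^sup>2 + f' * w\<^sup>2 + 2 * b' * u * v + 2 * c' * u * w + 2 * e' * v * w"
    by (intro tendsto_intros assms)
  then show "0 \<le> a' * u\<^sup>2 + d' * v\<^sup>2 + f' * w\<^sup>2 + 2 * b' * u * v + 2 * c' * u * w + 2 * e' * v * w"
    by (rule LIMSEQ_le_const) (use assms(1) in \<open>auto simp: psd3_def\<close>)
qed

text \<open>\<open>A\<close>, \<open>C\<close>, \<open>B\<close> are the entries R11, R12, R22, and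
  \<open>a\<close>, \<open>b\<close> are the entries of the vector r.\<close>

definition qpoly :: "real \<Rightarrow> real \<Rightarrow> real \<Rightarrow> real \<Rightarrow> real \<Rightarrow> real \<Rightarrow> real \<Rightarrow> real \<Rightarrow> real" where
  "qpoly A C B a b p x y = A * x\<^sup>2 + 2 * C * x * y + B * y\<^sup>2 + 2 * a * x + 2 * b * y + p"

definition cert :: "real \<Rightarrow> real \<Rightarrow> real \<Rightarrow> real \<Rightarrow> real \<Rightarrow> real \<Rightarrow> (nat \<Rightarrow> real) \<Rightarrow> bool" where
  "cert A C B a b p t \<longleftrightarrow>
    psd3 (p - t 11 - t 19) (a - t 1 / 2 - t 8 - t 12 / 2) (b - t 3 / 2 - t 4 / 2 - t 16)
      (A - t 6) (C - t 2 - t 5 - t 13 - 1 / 2 * (t 9 - t 11 + t 17 - t 19)) (B - t 14) \<and>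
    psd2 (t 1) (t 2) (t 3) \<and> psd2 (t 4) (t 5) (2 * (t 8 - t 7)) \<and>
    psd3 (t 6) (t 7) (t 8) (t 9) (t 10) (t 11) \<and>
    psd2 (t 12) (t 13) (2 * (t 16 - t 15)) \<and> psd3 (t 14) (t 15) (t 16) (t 17) (t 18) (t 19)"

lemma all_psd_iff_cert:
  "all_psd R r p t \<longleftrightarrow> cert (R$1$1) (R$1$2) (R$2$2) (r$1) (r$2) p t"
  unfolding all_psd_def cert_def Lambda1_def Let_def Lambda2_def Lambda3_def Lambda4_def Lambda5_def
    Lambda6_def psd_iff_psd2 psd_iff_psd3 ..

lemma q_eq_qpoly:
  assumes "transpose R = R"
  shows "q R r p x = qpoly (R$1$1) (R$1$2) (R$2$2) (r$1) (r$2) p (x$1) (x$2)"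
proof -
  have "R$2$1 = R$1$2"
    using assms by (simp add: transpose_def vec_eq_iff)
  then show ?thesis
    by (simp add: q_def qpoly_def quad_form_def inner_vec_def matrix_vector_mult_def sum_2
        algebra_simps power2_eq_square)
qed

text \<open>The first matrix is what remains of the coefficient matrix once the other terms are
  subtracted. The entries 2(t8 - t7) and 2(t16 - t15) make the cubic monomials cancel, and the
  quartic ones cancel between the weights x1 x2 and 1 - x1 x2.\<close>

lemma q_eq_certificate:
  assumes "transpose R = R"
  shows "q R r p x = certificate R r p t x"
  unfolding q_eq_qpoly[OF assms] qpoly_def certificate_def Let_def Lambda1_def Lambda2_def
    Lambda3_def Lambda4_def Lambda5_def Lambda6_def quad_form_2 quad_form_3 vector_2 vector_3
  by (simp add: algebra_simps power2_eq_square)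

lemma mem_nonneg_cone_iff:
  assumes "transpose R = R"
  shows "q R r p \<in> nonneg_cone S \<longleftrightarrow> (\<forall>x\<in>S. 0 \<le> q R r p x)"
  using assms unfolding nonneg_cone_def by auto

abbreviation inF :: "real \<Rightarrow> real \<Rightarrow> bool" where
  "inF x y \<equiv> 0 \<le> x \<and> 0 \<le> y \<and> x * y \<le> 1"

text \<open>The factors 0 and 1 are kept unsimplified so that every bracket is literally an instance
  of the form in \<open>psd2_def\<close> or \<open>psd3_def\<close> at the vector that the
  certificate prescribes.\<close>

lemma qpoly_decomposition:
  fixes t :: "nat \<Rightarrow> real"
  shows
  "qpoly A C B a b p x y =
    ((p - t 11 - t 19) * 1\<^sup>2 + (A - t 6) * x\<^sup>2 + (B - t 14) * y\<^sup>2
      + 2 * (a - t 1 / 2 - t 8 - t 12 / 2) * 1 * x + 2 * (b - t 3 / 2 - t 4 / 2 - t 16) * 1 * y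
      + 2 * (C - t 2 - t 5 - t 13 - 1 / 2 * (t 9 - t 11 + t 17 - t 19)) * x * y)
    + x * (t 1 * 1\<^sup>2 + 2 * t 2 * 1 * y + t 3 * y\<^sup>2)
    + y * (1 - x * y) * (t 1 * 0\<^sup>2 + 2 * t 2 * 0 * 1 + t 3 * 1\<^sup>2)
    + y * (t 4 * 1\<^sup>2 + 2 * t 5 * 1 * x + 2 * (t 8 - t 7) * x\<^sup>2)
    + x * y * (t 6 * x\<^sup>2 + t 9 * 1\<^sup>2 + t 11 * 0\<^sup>2 + 2 * t 7 * x * 1 + 2 * t 8 * x * 0 + 2 * t 10 * 1 * 0)
    + (1 - x * y) * (t 6 * x\<^sup>2 + t 9 * 0\<^sup>2 + t 11 * 1\<^sup>2 + 2 * t 7 * x * 0 + 2 * t 8 * x * 1 + 2 * t 10 * 0 * 1)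
    + x * (t 12 * 1\<^sup>2 + 2 * t 13 * 1 * y + 2 * (t 16 - t 15) * y\<^sup>2)
    + x * y * (t 14 * y\<^sup>2 + t 17 * 1\<^sup>2 + t 19 * 0\<^sup>2 + 2 * t 15 * y * 1 + 2 * t 16 * y * 0 + 2 * t 18 * 1 * 0)
    + (1 - x * y) * (t 14 * y\<^sup>2 + t 17 * 0\<^sup>2 + t 19 * 1\<^sup>2 + 2 * t 15 * y * 0 + 2 * t 16 * y * 1 + 2 * t 18 * 0 * 1)"
  unfolding qpoly_def by (simp add: algebra_simps power2_eq_square)

section \<open>A priori bounds on the parameters of a certificate\<close>

lemma cert_terms_bounded:
  assumes "cert A C B a b p t" "inF x y"
  defines "Q \<equiv> qpoly A C B a b p x y"
  shows "0 \<le> Q"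
    and "x * (t 1 + 2 * t 2 * y + t 3 * y\<^sup>2) \<le> Q"
    and "y * (t 4 + 2 * t 5 * x + 2 * (t 8 - t 7) * x\<^sup>2) \<le> Q"
    and "x * y * (t 9 + 2 * t 7 * x + t 6 * x\<^sup>2) \<le> Q"
    and "(1 - x * y) * (t 11 + 2 * t 8 * x + t 6 * x\<^sup>2) \<le> Q"
    and "x * (t 12 + 2 * t 13 * y + 2 * (t 16 - t 15) * y\<^sup>2) \<le> Q"
    and "x * y * (t 17 + 2 * t 15 * y + t 14 * y\<^sup>2) \<le> Q"
    and "(1 - x * y) * (t 19 + 2 * t 16 * y + t 14 * y\<^sup>2) \<le> Q"
proof -
  define f1 where "f1 = (p - t 11 - t 19) * 1\<^sup>2 + (A - t 6) * x\<^sup>2 + (B - t 14) * y\<^sup>2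
      + 2 * (a - t 1 / 2 - t 8 - t 12 / 2) * 1 * x + 2 * (b - t 3 / 2 - t 4 / 2 - t 16) * 1 * y
      + 2 * (C - t 2 - t 5 - t 13 - 1 / 2 * (t 9 - t 11 + t 17 - t 19)) * x * y"
  define f2 where "f2 = t 1 * 1\<^sup>2 + 2 * t 2 * 1 * y + t 3 * y\<^sup>2"
  define f2' where "f2' = t 1 * 0\<^sup>2 + 2 * t 2 * 0 * 1 + t 3 * 1\<^sup>2"
  define f3 where "f3 = t 4 * 1\<^sup>2 + 2 * t 5 * 1 * x + 2 * (t 8 - t 7) * x\<^sup>2"
  define f4 where "f4 = t 6 * x\<^sup>2 + t 9 * 1\<^sup>2 + t 11 * 0\<^sup>2 + 2 * t 7 * x * 1 + 2 * t 8 * x * 0 + 2 * t 10 * 1 * 0"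
  define f4' where "f4' = t 6 * x\<^sup>2 + t 9 * 0\<^sup>2 + t 11 * 1\<^sup>2 + 2 * t 7 * x * 0 + 2 * t 8 * x * 1 + 2 * t 10 * 0 * 1"
  define f5 where "f5 = t 12 * 1\<^sup>2 + 2 * t 13 * 1 * y + 2 * (t 16 - t 15) * y\<^sup>2"
  define f6 where "f6 = t 14 * y\<^sup>2 + t 17 * 1\<^sup>2 + t 19 * 0\<^sup>2 + 2 * t 15 * y * 1 + 2 * t 16 * y * 0 + 2 * t 18 * 1 * 0"
  define f6' where "f6' = t 14 * y\<^sup>2 + t 17 * 0\<^sup>2 + t 19 * 1\<^sup>2 + 2 * t 15 * y * 0 + 2 * t 16 * y * 1 + 2 * t 18 * 0 * 1"
  note defs = f1_def f2_def f2'_def f3_def f4_def f4'_def f5_def f6_def f6'_def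
  have "0 \<le> f1" "0 \<le> f2" "0 \<le> f2'" "0 \<le> f3" "0 \<le> f4" "0 \<le> f4'" "0 \<le> f5" "0 \<le> f6" "0 \<le> f6'"
    using assms(1) unfolding cert_def psd2_def psd3_def defs by blast+
  then have nonneg: "0 \<le> x * f2" "0 \<le> y * (1 - x * y) * f2'" "0 \<le> y * f3" "0 \<le> x * y * f4"
    "0 \<le> (1 - x * y) * f4'" "0 \<le> x * f5" "0 \<le> x * y * f6" "0 \<le> (1 - x * y) * f6'" "0 \<le> f1"
    using assms(2) by simp_all
  have sum: "Q = f1 + x * f2 + y * (1 - x * y) * f2' + y * f3 + x * y * f4 + (1 - x * y) * f4'
      + x * f5 + x * y * f6 + (1 - x * y) * f6'"
    unfolding Q_def defs by (rule qpoly_decomposition)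
  \<comment> \<open>\<open>Q\<close> is a sum of nonnegative terms, so it dominates each of
    them.\<close>
  have le: "0 \<le> Q" "x * f2 \<le> Q" "y * f3 \<le> Q" "x * y * f4 \<le> Q"
    "(1 - x * y) * f4' \<le> Q" "x * f5 \<le> Q" "x * y * f6 \<le> Q" "(1 - x * y) * f6' \<le> Q"
    using nonneg sum by linarith+
  show "0 \<le> Q"
    and "x * (t 1 + 2 * t 2 * y + t 3 * y\<^sup>2) \<le> Q"
    and "y * (t 4 + 2 * t 5 * x + 2 * (t 8 - t 7) * x\<^sup>2) \<le> Q"
    and "x * y * (t 9 + 2 * t 7 * x + t 6 * x\<^sup>2) \<le> Q"
    and "(1 - x * y) * (t 11 + 2 * t 8 * x + t 6 * x\<^sup>2) \<le> Q"
    and "x * (t 12 + 2 * t 13 * y + 2 * (t 16 - t 15) * y\<^sup>2) \<le> Q"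
    and "x * y * (t 17 + 2 * t 15 * y + t 14 * y\<^sup>2) \<le> Q"
    and "(1 - x * y) * (t 19 + 2 * t 16 * y + t 14 * y\<^sup>2) \<le> Q"
    using le by (simp_all add: defs add_ac)
qed

text \<open>For f(s) = a + 2 b s + c s^2, nonnegative everywhere and at most M at 1/4 and 1/2, the
  second difference over 1/4, 3/8, 1/2 is c/32, so c \<le> 64 M. The two values then control
  \<open>a\<close> and \<open>b\<close>; 200 is a crude common constant.\<close>

lemma psd2_bounded:
  assumes "psd2 a b c" "a + 2 * b * (1/4) + c * (1/4)\<^sup>2 \<le> M" "a + 2 * b * (1/2) + c * (1/2)\<^sup>2 \<le> M"
  shows "\<bar>a\<bar> \<le> 200 * M" "\<bar>b\<bar> \<le> 200 * M" "\<bar>c\<bar> \<le> 200 * M"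
proof -
  have *: "0 \<le> a * u\<^sup>2 + 2 * b * u * v + c * v\<^sup>2" for u v
    using assms(1) unfolding psd2_def by blast
  show "\<bar>a\<bar> \<le> 200 * M" "\<bar>b\<bar> \<le> 200 * M" "\<bar>c\<bar> \<le> 200 * M"
    using assms(2,3) *[of 1 0] *[of 0 1] *[of 1 1] *[of 1 "-1"] *[of 3 1] *[of "2" "3/4"] *[of 1 "1/4"] *[of 1 "1/2"]
    unfolding power2_eq_square by (simp_all add: field_simps abs_le_iff)
qed

text \<open>The 2x2 minors list the entry \<open>a\<close> last so that they match the polynomials
  t9 + 2 t7 x + t6 x^2 and t11 + 2 t8 x + t6 x^2 bounded in \<open>cert_terms_bounded\<close>. The
  entry \<open>e\<close>, where t10 and t18 sit, is controlled through the diagonal.\<close>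

lemma psd3_minors:
  assumes "psd3 a b c d e f"
  shows "psd2 d b a" "psd2 f c a" "\<bar>e\<bar> \<le> \<bar>d\<bar> + \<bar>f\<bar>"
proof -
  have *: "0 \<le> a * u\<^sup>2 + d * v\<^sup>2 + f * w\<^sup>2 + 2 * b * u * v + 2 * c * u * w + 2 * e * v * w" for u v w
    using assms(1) unfolding psd3_def by blast
  show "psd2 d b a" unfolding psd2_def
  proof (intro allI)
    fix u v show "0 \<le> d * u\<^sup>2 + 2 * b * u * v + a * v\<^sup>2" using *[of v u 0] by (simp add: algebra_simps)
  qed
  show "psd2 f c a" unfolding psd2_def
  proof (intro allI)
    fix u v show "0 \<le> f * u\<^sup>2 + 2 * c * u * v + a * v\<^sup>2" using *[of v 0 u] by (simp add: algebra_simps)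
  qed
  show "\<bar>e\<bar> \<le> \<bar>d\<bar> + \<bar>f\<bar>"
    using *[of 0 1 1] *[of 0 1 "-1"] by simp
qed

lemma qpoly_le:
  assumes "\<bar>A\<bar> \<le> N" "\<bar>C\<bar> \<le> N" "\<bar>B\<bar> \<le> N" "\<bar>a\<bar> \<le> N" "\<bar>b\<bar> \<le> N" "\<bar>p\<bar> \<le> N"
    and "0 \<le> x" "x \<le> 1" "0 \<le> y" "y \<le> 1"
  shows "qpoly A C B a b p x y \<le> 9 * N"
proof -
  have *: "c * s \<le> N" if "\<bar>c\<bar> \<le> N" "0 \<le> s" "s \<le> 1" for c s
  proof -
    have "c * s \<le> \<bar>c\<bar> * s" using that by (intro mult_right_mono) auto
    also have "\<dots> \<le> \<bar>c\<bar> * 1" using that by (intro mult_left_mono) auto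
    finally show ?thesis using that by simp
  qed
  have "x * y \<le> 1" "x\<^sup>2 \<le> 1" "y\<^sup>2 \<le> 1"
    using assms by (simp_all add: mult_le_one power_le_one)
  then have "A * x\<^sup>2 \<le> N" "C * (x * y) \<le> N" "B * y\<^sup>2 \<le> N" "a * x \<le> N" "b * y \<le> N"
    using assms by (simp_all add: *)
  then show ?thesis
    unfolding qpoly_def using assms(6) by (simp add: algebra_simps)
qed

text \<open>On the square [1/4, 1/2]^2 inside the region the quadratic is at most 9N and the weights
  x, y, xy, 1 - xy are at least 1/16. Hence each form occurring with such a weight is at most 16 *
  9N = 144N there, which bounds its coefficients. This is the compactness behind the closedness of
  the certificate cone.\<close>

lemma cert_parameters_bounded:
  assumes c: "cert A C B a b p t"
    and N: "\<bar>A\<bar> \<le> N" "\<bar>C\<bar> \<le> N" "\<bar>B\<bar> \<le> N" "\<bar>a\<bar> \<le> N" "\<bar>b\<bar> \<le> N" "\<bar>p\<bar> \<le> N"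
    and i: "1 \<le> i" "i \<le> 19"
  shows "\<bar>t i\<bar> \<le> 10^6 * N"
proof -
  have N0: "0 \<le> N" using N(1) by linarith
  have le: "E \<le> 144 * N" if "s * E \<le> Q" "Q \<le> 9 * N" "1/16 \<le> s" for E s Q
  proof (cases "0 \<le> E")
    case True
    then have "1/16 * E \<le> s * E" using that by (intro mult_right_mono)
    then show ?thesis using that by simp
  qed (use N0 in simp)
  have B: "t 1 + 2 * t 2 * y + t 3 * y\<^sup>2 \<le> 144 * N"
    "t 4 + 2 * t 5 * x + 2 * (t 8 - t 7) * x\<^sup>2 \<le> 144 * N"
    "t 9 + 2 * t 7 * x + t 6 * x\<^sup>2 \<le> 144 * N"
    "t 11 + 2 * t 8 * x + t 6 * x\<^sup>2 \<le> 144 * N"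
    "t 12 + 2 * t 13 * y + 2 * (t 16 - t 15) * y\<^sup>2 \<le> 144 * N"
    "t 17 + 2 * t 15 * y + t 14 * y\<^sup>2 \<le> 144 * N"
    "t 19 + 2 * t 16 * y + t 14 * y\<^sup>2 \<le> 144 * N"
    if xy: "1/4 \<le> x" "x \<le> 1/2" "1/4 \<le> y" "y \<le> 1/2" for x y
  proof -
    have Q: "qpoly A C B a b p x y \<le> 9 * N"
      using N xy by (intro qpoly_le) auto
    have "1/4 * (1/4) \<le> x * y" "x * y \<le> 1/2 * (1/2)"
      using xy by (intro mult_mono; simp)+
    then have s: "1/16 \<le> x" "1/16 \<le> y" "1/16 \<le> x * y" "1/16 \<le> 1 - x * y" and F: "inF x y"
      using xy by auto
    note T = cert_terms_bounded[OF c F]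
    show "t 1 + 2 * t 2 * y + t 3 * y\<^sup>2 \<le> 144 * N" by (rule le[OF T(2) Q s(1)])
    show "t 4 + 2 * t 5 * x + 2 * (t 8 - t 7) * x\<^sup>2 \<le> 144 * N" by (rule le[OF T(3) Q s(2)])
    show "t 9 + 2 * t 7 * x + t 6 * x\<^sup>2 \<le> 144 * N" by (rule le[OF T(4) Q s(3)])
    show "t 11 + 2 * t 8 * x + t 6 * x\<^sup>2 \<le> 144 * N" by (rule le[OF T(5) Q s(4)])
    show "t 12 + 2 * t 13 * y + 2 * (t 16 - t 15) * y\<^sup>2 \<le> 144 * N" by (rule le[OF T(6) Q s(1)])
    show "t 17 + 2 * t 15 * y + t 14 * y\<^sup>2 \<le> 144 * N" by (rule le[OF T(7) Q s(3)])
    show "t 19 + 2 * t 16 * y + t 14 * y\<^sup>2 \<le> 144 * N" by (rule le[OF T(8) Q s(4)])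
  qed
  have "(1/4::real) \<le> 1/4" "(1/4::real) \<le> 1/2" "(1/2::real) \<le> 1/2" by simp_all
  \<comment> \<open>The points (1/4, 1/4) and (1/2, 1/2) supply the two values that
    \<open>psd2_bounded\<close> asks for.\<close>
  note B4 = B[OF this(1,2,1,2)] and B2 = B[OF this(2,3,2,3)]
  have P: "psd2 (t 1) (t 2) (t 3)" "psd2 (t 4) (t 5) (2 * (t 8 - t 7))"
    "psd3 (t 6) (t 7) (t 8) (t 9) (t 10) (t 11)"
    "psd2 (t 12) (t 13) (2 * (t 16 - t 15))" "psd3 (t 14) (t 15) (t 16) (t 17) (t 18) (t 19)"
    using c unfolding cert_def by auto
  note b = psd2_bounded[OF P(1) B4(1) B2(1)] psd2_bounded(1,2)[OF P(2) B4(2) B2(2)]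
    psd2_bounded[OF psd3_minors(1)[OF P(3)] B4(3) B2(3)]
    psd2_bounded(1,2)[OF psd3_minors(2)[OF P(3)] B4(4) B2(4)]
    psd2_bounded(1,2)[OF P(4) B4(5) B2(5)]
    psd2_bounded[OF psd3_minors(1)[OF P(5)] B4(6) B2(6)]
    psd2_bounded(1,2)[OF psd3_minors(2)[OF P(5)] B4(7) B2(7)]
  have b': "\<bar>t 10\<bar> \<le> \<bar>t 9\<bar> + \<bar>t 11\<bar>" "\<bar>t 18\<bar> \<le> \<bar>t 17\<bar> + \<bar>t 19\<bar>"
    using psd3_minors(3) P by blast+
  \<comment> \<open>The constant 10^6 also leaves room for the sum of two such bounds, as needed for
    t10 and t18.\<close>
  have up: "200 * (144 * N) \<le> 10^6 * N" using N0 by simp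
  have "\<bar>t 10\<bar> \<le> 10^6 * N"
    by (rule order_trans[OF b'(1)], rule order_trans[OF add_mono[OF b(6) b(9)]]) (use N0 in simp)
  moreover have "\<bar>t 18\<bar> \<le> 10^6 * N"
    by (rule order_trans[OF b'(2)], rule order_trans[OF add_mono[OF b(13) b(16)]]) (use N0 in simp)
  moreover note b[THEN order_trans, OF up]
  ultimately have bounds: "\<forall>j\<in>{1, 2, 3, 4, 5, 6, 7, 8, 9, 10, 11, 12, 13, 14, 15, 16, 17, 18, 19}. \<bar>t j\<bar> \<le> 10^6 * N"
    by (simp only: ball_simps simp_thms)
  have "{..<20::nat} = {0, 1, 2, 3, 4, 5, 6, 7, 8, 9, 10, 11, 12, 13, 14, 15, 16, 17, 18, 19}"
    unfolding lessThan_nat_numeral pred_numeral_simps BitM.simps lessThan_0 by auto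
  moreover have "i \<in> {..<20}" and i0: "i \<noteq> 0"
    using i by simp_all
  ultimately have "i \<in> {0, 1, 2, 3, 4, 5, 6, 7, 8, 9, 10, 11, 12, 13, 14, 15, 16, 17, 18, 19}"
    by (simp only:)
  then have "i \<in> {1, 2, 3, 4, 5, 6, 7, 8, 9, 10, 11, 12, 13, 14, 15, 16, 17, 18, 19}"
    by (rule insertE) (use i0 in simp)
  then show ?thesis by (rule bounds[rule_format])
qed

section \<open>Moments carried by two points of the region\<close>

lemma nonneg_quadratic_leading_coeff:
  fixes A a p :: real
  assumes "\<And>x. 0 \<le> x \<Longrightarrow> 0 \<le> A * x\<^sup>2 + 2 * a * x + p"
  shows "0 \<le> A"
proof (rule ccontr)
  assume "\<not> 0 \<le> A"
  then have A: "A < 0" by simp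
  \<comment> \<open>Chosen so that A x + 2|a| + |p| = A. Since x \<ge> 1, the quadratic at x is at
    most x times this negative number.\<close>
  define x where "x = 1 + (2 * \<bar>a\<bar> + \<bar>p\<bar>) / (- A)"
  have Ax: "A * x + 2 * \<bar>a\<bar> + \<bar>p\<bar> = A" using A unfolding x_def by (simp add: field_simps)
  moreover have x: "1 \<le> x" using A unfolding x_def by (simp add: field_simps)
  moreover have "2 * a * x \<le> 2 * \<bar>a\<bar> * x" "p \<le> \<bar>p\<bar> * x"
    using x mult_left_mono[of 1 x "\<bar>p\<bar>"] by (auto intro!: mult_right_mono)
  moreover have "A * x\<^sup>2 + 2 * \<bar>a\<bar> * x + \<bar>p\<bar> * x = (A * x + 2 * \<bar>a\<bar> + \<bar>p\<bar>) * x"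
    by (simp add: algebra_simps power2_eq_square)
  ultimately have "A * x\<^sup>2 + 2 * a * x + p \<le> A * x"
    unfolding Ax by linarith
  also have "\<dots> < 0" using A x by (simp add: mult_neg_pos)
  finally show False using assms[of x] \<open>1 \<le> x\<close> by simp
qed

text \<open>A probability measure on at most two points of the region with the mean and mixed moment
  prescribed exactly, while the second moments may fall short of \<open>X\<close> and
  \<open>W\<close>.\<close>

definition represented :: "real \<Rightarrow> real \<Rightarrow> real \<Rightarrow> real \<Rightarrow> real \<Rightarrow> bool" where
  "represented X Z W x y \<longleftrightarrow> (\<exists>l u v u' v'. 0 \<le> l \<and> l \<le> 1 \<and> inF u v \<and> inF u' v' \<and>
     l * u + (1 - l) * u' = x \<and> l * v + (1 - l) * v' = y \<and> l * (u * v) + (1 - l) * (u' * v') = Z \<and>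
     l * u\<^sup>2 + (1 - l) * u'\<^sup>2 \<le> X \<and> l * v\<^sup>2 + (1 - l) * v'\<^sup>2 \<le> W)"

lemma representedI:
  assumes "0 \<le> l" "l \<le> 1" "inF u v" "inF u' v'"
    and "l * u + (1 - l) * u' = x" "l * v + (1 - l) * v' = y"
    and "l * (u * v) + (1 - l) * (u' * v') = Z"
    and "l * u\<^sup>2 + (1 - l) * u'\<^sup>2 \<le> X" "l * v\<^sup>2 + (1 - l) * v'\<^sup>2 \<le> W"
  shows "represented X Z W x y"
  using assms unfolding represented_def by blast

lemma represented_swap:
  assumes "represented X Z W x y"
  shows "represented W Z X y x"
  using assms unfolding represented_def by (metis mult.commute)

text \<open>The expectation of the quadratic over the two points is nonnegative. Replacing the
  actual second moments by \<open>X\<close> and \<open>W\<close> can only increase the value,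
  because nonnegativity on the half-axes forces \<open>A\<close> and \<open>B\<close> to be
  nonnegative.\<close>

lemma represented_nonneg:
  assumes rep: "represented X Z W x y"
    and nn: "\<And>u v. inF u v \<Longrightarrow> 0 \<le> qpoly A C B a b p u v"
  shows "0 \<le> A * X + 2 * C * Z + B * W + 2 * a * x + 2 * b * y + p"
proof -
  obtain l u v u' v' where l: "0 \<le> l" "l \<le> 1" and F: "inF u v" "inF u' v'"
    and e: "l * u + (1 - l) * u' = x" "l * v + (1 - l) * v' = y"
      "l * (u * v) + (1 - l) * (u' * v') = Z"
    and le: "l * u\<^sup>2 + (1 - l) * u'\<^sup>2 \<le> X" "l * v\<^sup>2 + (1 - l) * v'\<^sup>2 \<le> W"
    using rep unfolding represented_def by blast
  have "0 \<le> A * x\<^sup>2 + 2 * a * x + p" if "0 \<le> x" for x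
    using nn[of x 0] that by (simp add: qpoly_def)
  then have "0 \<le> A" by (rule nonneg_quadratic_leading_coeff)
  have "0 \<le> B * x\<^sup>2 + 2 * b * x + p" if "0 \<le> x" for x
    using nn[of 0 x] that by (simp add: qpoly_def)
  then have "0 \<le> B" by (rule nonneg_quadratic_leading_coeff)
  have "0 \<le> l * qpoly A C B a b p u v + (1 - l) * qpoly A C B a b p u' v'"
    using nn F l by simp
  also have "\<dots> = A * (l * u\<^sup>2 + (1 - l) * u'\<^sup>2) + 2 * C * Z + B * (l * v\<^sup>2 + (1 - l) * v'\<^sup>2) + 2 * a * x + 2 * b * y + p"
    unfolding qpoly_def e[symmetric] by (simp add: algebra_simps)
  also have "\<dots> \<le> A * X + 2 * C * Z + B * W + 2 * a * x + 2 * b * y + p"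
    using mult_left_mono[OF le(1) \<open>0 \<le> A\<close>] mult_left_mono[OF le(2) \<open>0 \<le> B\<close>] by simp
  finally show ?thesis .
qed

text \<open>A monic quadratic that is negative at \<open>x\<close> has two real roots with
  \<open>x\<close> strictly between them.\<close>

lemma quadratic_roots_around:
  fixes S P x :: real
  assumes "x\<^sup>2 - S * x + P < 0"
  obtains u u' where "u < x" "x < u'" "u + u' = S" "u * u' = P"
proof -
  define D where "D = sqrt (S\<^sup>2 - 4 * P)"
  have "(2 * x - S)\<^sup>2 < S\<^sup>2 - 4 * P"
    using assms by (simp add: power2_eq_square algebra_simps)
  then have lt: "\<bar>2 * x - S\<bar> < D" and D: "D * D = S\<^sup>2 - 4 * P"
    unfolding D_def
    using real_less_rsqrt[of "\<bar>2 * x - S\<bar>" "S\<^sup>2 - 4 * P"] 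
    by (simp_all, smt (verit) zero_le_power2)
  show thesis
  proof (rule that)
    show "(S - D) / 2 < x" "x < (S + D) / 2" "(S - D) / 2 + (S + D) / 2 = S"
      using lt by (simp_all add: abs_less_iff field_simps)
    show "(S - D) / 2 * ((S + D) / 2) = P"
      using D by (simp add: field_simps power2_eq_square)
  qed
qed

text \<open>Both points lie on the hyperbola \<open>u * v = Z\<close>, where the regression line of the moments cuts it.\<close>

lemma represented_negative_correlation:
  assumes pos: "0 < x" "0 < y" "0 < Z" "Z < 1" "x\<^sup>2 < X"
    and det: "(Z - x * y)\<^sup>2 \<le> (X - x\<^sup>2) * (W - y\<^sup>2)" and neg: "Z < x * y"
  shows "represented X Z W x y"
proof -
  \<comment> \<open>The regression line through (x, y) has slope -1/m, that is u + m v = x + m y. On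
    the hyperbola u v = Z this becomes u^2 - (x + m y) u + m Z = 0, and if u is one root, the second
    coordinate Z/u is the other root divided by m.\<close>
  define m where "m = (X - x\<^sup>2) / (x * y - Z)"
  have m: "0 < m" and X: "X = x\<^sup>2 + m * (x * y - Z)"
    using pos neg unfolding m_def by (simp_all add: field_simps)
  have "m * Z < m * (x * y)" using m neg by simp
  then have "x\<^sup>2 - (x + m * y) * x + m * Z < 0"
    by (simp add: algebra_simps power2_eq_square)
  then obtain u u' where u: "u < x" "x < u'" "u + u' = x + m * y" "u * u' = m * Z"
    by (rule quadratic_roots_around)
  have "0 < u * u'" using u(4) m pos by simp
  then have "0 < u" "0 < u'" using u(2) pos(1) by (auto simp: zero_less_mult_iff)
  \<comment> \<open>The weight that makes the mean of the first coordinate equal to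
    \<open>x\<close>.\<close>
  define l where "l = (u' - x) / (u' - u)"
  have d: "0 < u' - u" using u by simp
  have l: "0 \<le> l" "l \<le> 1" using u d unfolding l_def by (simp_all add: field_simps)
  have ld: "l * (u' - u) = u' - x" using d by (simp add: l_def)
  have e1: "l * u + (1 - l) * u' = x" using ld by (simp add: algebra_simps)
  have v: "u' / m * u = Z" "u / m * u' = Z" using u(4) m by (simp_all add: field_simps)
  have e2: "l * (u' / m) + (1 - l) * (u / m) = y"
  proof -
    have "l * u' + (1 - l) * u = m * y" using e1 u(3) by (simp add: algebra_simps)
    then show ?thesis using m by (simp add: field_simps)
  qed
  have e3: "l * u\<^sup>2 + (1 - l) * u'\<^sup>2 = X"
  proof -
    have "u\<^sup>2 = (x + m * y) * u - m * Z" "u'\<^sup>2 = (x + m * y) * u' - m * Z"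
      unfolding u(3,4)[symmetric] by (simp_all add: algebra_simps power2_eq_square)
    then have "l * u\<^sup>2 + (1 - l) * u'\<^sup>2 = (x + m * y) * (l * u + (1 - l) * u') - m * Z"
      by (simp only:) (simp add: algebra_simps)
    then show ?thesis unfolding e1 X by (simp add: algebra_simps power2_eq_square)
  qed
  \<comment> \<open>Both atoms lie on the regression line, so the second moment of the second
    coordinate is y^2 + (Z - x y)^2 / (X - x^2), which the determinant condition keeps below
    \<open>W\<close>.\<close>
  have e4: "l * (u' / m)\<^sup>2 + (1 - l) * (u / m)\<^sup>2 \<le> W"
  proof -
    have "u\<^sup>2 = (x + m * y) * u - m * Z" "u'\<^sup>2 = (x + m * y) * u' - m * Z"
      unfolding u(3,4)[symmetric] by (simp_all add: algebra_simps power2_eq_square)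
    then have "l * u'\<^sup>2 + (1 - l) * u\<^sup>2 = (x + m * y) * (l * u' + (1 - l) * u) - m * Z"
      by (simp only:) (simp add: algebra_simps)
    also have "l * u' + (1 - l) * u = m * y" using e1 u(3) by (simp add: algebra_simps)
    finally have "l * u'\<^sup>2 + (1 - l) * u\<^sup>2 = m * (m * y\<^sup>2 + (x * y - Z))"
      by (simp add: algebra_simps power2_eq_square)
    moreover have "l * (u' / m)\<^sup>2 + (1 - l) * (u / m)\<^sup>2 = (l * u'\<^sup>2 + (1 - l) * u\<^sup>2) / m\<^sup>2"
      by (simp add: power_divide add_divide_distrib)
    ultimately have "l * (u' / m)\<^sup>2 + (1 - l) * (u / m)\<^sup>2 = m * (m * y\<^sup>2 + (x * y - Z)) / m\<^sup>2"
      by (simp only:)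
    also have "\<dots> = y\<^sup>2 + (x * y - Z) / m"
      using m by (simp add: power2_eq_square add_divide_distrib)
    also have "(x * y - Z) / m = (Z - x * y)\<^sup>2 / (X - x\<^sup>2)"
      using neg unfolding m_def by (simp add: power2_eq_square algebra_simps)
    also have "\<dots> \<le> W - y\<^sup>2" using det pos by (simp add: divide_le_eq mult.commute)
    finally show ?thesis by simp
  qed
  show ?thesis
  proof (rule representedI[OF l _ _ e1 e2 _ _ e4])
    show "inF u (u' / m)" "inF u' (u / m)"
      using \<open>0 < u\<close> \<open>0 < u'\<close> m v pos by (simp_all add: mult.commute)
    show "l * (u * (u' / m)) + (1 - l) * (u' * (u / m)) = Z"
      using v by (simp add: mult.commute algebra_simps)
    show "l * u\<^sup>2 + (1 - l) * u'\<^sup>2 \<le> X"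
      using e3 by simp
  qed
qed

text \<open>The point mass at (x, y) suffices; the origin enters with weight 0.\<close>

lemma represented_uncorrelated:
  assumes pos: "0 < x" "0 < y" "Z < 1" "x\<^sup>2 < X" "y\<^sup>2 < W" and "Z = x * y"
  shows "represented X Z W x y"
  by (rule representedI[of 1 x y 0 0]) (use assms in auto)

text \<open>The points are \<open>(Z / y, y / w)\<close> with weight \<open>w\<close> and a point \<open>(\<alpha>, 0)\<close> on the axis.\<close>

lemma represented_axis_atom:
  assumes w: "0 < w" "w < 1" "Z \<le> w" "w * Z \<le> x * y" and pos: "0 < y" "0 < Z"
    and W: "y\<^sup>2 \<le> w * W" and X: "w * (Z / y)\<^sup>2 + (x - w * (Z / y))\<^sup>2 / (1 - w) \<le> X"
  shows "represented X Z W x y"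
proof -
  \<comment> \<open>Chosen to make the mean of the first coordinate \<open>x\<close>. The condition
    w Z \<le> x y gives \<alpha> \<ge> 0, Z \<le> w keeps the other atom below the hyperbola, and
    y^2 \<le> w W bounds the second moment y^2 / w.\<close>
  define \<alpha> where "\<alpha> = (x - w * (Z / y)) / (1 - w)"
  have ne: "1 - w \<noteq> 0" using w by simp
  have \<alpha>: "(1 - w) * \<alpha> = x - w * (Z / y)"
    unfolding \<alpha>_def using ne by simp
  show ?thesis
  proof (rule representedI[of w "Z / y" "y / w" \<alpha> 0])
    have "0 \<le> \<alpha>"
      unfolding \<alpha>_def using w pos by (simp add: field_simps)
    then show "inF \<alpha> 0" by simp
    show "0 \<le> w" "w \<le> 1" using w by simp_all
    show "inF (Z / y) (y / w)"
      using w pos by (simp add: field_simps)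
    show "w * (Z / y) + (1 - w) * \<alpha> = x"
      using \<alpha> by simp
    show "w * (y / w) + (1 - w) * 0 = y" "w * (Z / y * (y / w)) + (1 - w) * (\<alpha> * 0) = Z"
      using w pos by simp_all
    have "(1 - w) * \<alpha>\<^sup>2 = (x - w * (Z / y))\<^sup>2 / (1 - w)"
      unfolding \<alpha>_def using ne by (simp add: power2_eq_square)
    then show "w * (Z / y)\<^sup>2 + (1 - w) * \<alpha>\<^sup>2 \<le> X"
      using X by simp
    show "w * (y / w)\<^sup>2 + (1 - w) * 0\<^sup>2 \<le> W"
      using w W by (simp add: power2_eq_square field_simps)
  qed
qed

text \<open>If y^2 \<le> Z W, the weight w = Z puts the atom off the axis on the boundary hyperbola,
  and the hypothesis on \<open>X\<close> is exactly the required bound. Otherwise w = y^2 / W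
  attains the second moment \<open>W\<close>, and the bound on \<open>X\<close> comes from the
  determinant.\<close>

lemma represented_positive_correlation_aux:
  assumes pos: "0 < x" "0 < y" "0 < Z" "Z < 1" "y\<^sup>2 < W"
    and det: "(Z - x * y)\<^sup>2 \<le> (X - x\<^sup>2) * (W - y\<^sup>2)" and Z: "Z\<^sup>2 \<le> x * y"
    and X: "Z * (Z / y)\<^sup>2 + (x - Z * (Z / y))\<^sup>2 / (1 - Z) \<le> X"
    and W: "y * Z \<le> x * W"
  shows "represented X Z W x y"
proof (cases "y\<^sup>2 \<le> Z * W")
  case True
  then show ?thesis
    using represented_axis_atom[of Z Z x y W X] assms by (simp add: power2_eq_square)
next
  case False
  define w where "w = y\<^sup>2 / W"
  have W0: "0 < W" using pos by (smt (verit) zero_le_power2)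
  have d: "0 < W - y\<^sup>2" using pos by simp
  have "w * (Z / y)\<^sup>2 = Z\<^sup>2 / W"
    unfolding w_def using pos W0 by (simp add: field_simps)
  moreover have "x - w * (Z / y) = (x * W - y * Z) / W"
    unfolding w_def using pos W0 by (simp add: field_simps power2_eq_square)
  moreover have "1 - w = (W - y\<^sup>2) / W"
    unfolding w_def using pos W0 by (simp add: field_simps)
  ultimately have "w * (Z / y)\<^sup>2 + (x - w * (Z / y))\<^sup>2 / (1 - w)
      = Z\<^sup>2 / W + ((x * W - y * Z) / W)\<^sup>2 / ((W - y\<^sup>2) / W)"
    by simp
  \<comment> \<open>The computation arrives at x^2 + (Z - x y)^2 / (W - y^2), the value of
    \<open>X\<close> at which the covariance determinant vanishes.\<close>
  also have "\<dots> = (Z\<^sup>2 * (W - y\<^sup>2) + (x * W - y * Z)\<^sup>2) / (W * (W - y\<^sup>2))"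
    using W0 d by (simp add: power2_eq_square add_divide_distrib)
  also have "Z\<^sup>2 * (W - y\<^sup>2) + (x * W - y * Z)\<^sup>2 = W * ((Z - x * y)\<^sup>2 + x\<^sup>2 * (W - y\<^sup>2))"
    by (simp add: algebra_simps power2_eq_square)
  also have "\<dots> / (W * (W - y\<^sup>2)) = (Z - x * y)\<^sup>2 / (W - y\<^sup>2) + x\<^sup>2"
    using W0 d by (simp add: add_divide_distrib)
  also have "\<dots> \<le> (X - x\<^sup>2) + x\<^sup>2"
    using det d by (intro add_right_mono) (simp add: divide_le_eq)
  finally have "w * (Z / y)\<^sup>2 + (x - w * (Z / y))\<^sup>2 / (1 - w) \<le> X" by simp
  moreover have "0 < w" "w < 1" "Z \<le> w" "y\<^sup>2 \<le> w * W"
    unfolding w_def using pos W0 d False by (simp_all add: field_simps)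
  moreover have "w * Z \<le> x * y"
  proof -
    have "y * (y * Z) \<le> y * (x * W)" using W pos by simp
    then show ?thesis unfolding w_def using W0 by (simp add: field_simps power2_eq_square)
  qed
  ultimately show ?thesis
    using represented_axis_atom pos by blast
qed

text \<open>The second atom may be sought on either axis; its coordinate is nonnegative when y Z
  \<le> x W or x Z \<le> y X respectively, and the determinant condition rules out that both
  fail.\<close>

lemma represented_positive_correlation:
  assumes pos: "0 < x" "0 < y" "0 < Z" "Z < 1" "x\<^sup>2 < X" "y\<^sup>2 < W" "x * y < Z"
    and det: "(Z - x * y)\<^sup>2 \<le> (X - x\<^sup>2) * (W - y\<^sup>2)" and Z: "Z\<^sup>2 \<le> x * y"
    and X: "Z * (Z / y)\<^sup>2 + (x - Z * (Z / y))\<^sup>2 / (1 - Z) \<le> X"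
    and W: "Z * (Z / x)\<^sup>2 + (y - Z * (Z / x))\<^sup>2 / (1 - Z) \<le> W"
  shows "represented X Z W x y"
proof (cases "y * Z \<le> x * W")
  case True
  then show ?thesis
    using represented_positive_correlation_aux assms by blast
next
  case False
  have "x * Z \<le> y * X"
  proof (rule ccontr)
    assume "\<not> x * Z \<le> y * X"
    \<comment> \<open>Multiplying the two failed inequalities gives (X - x^2)(W - y^2) < (Z - x
      y)^2.\<close>
    then have "y * (X - x\<^sup>2) < x * (Z - x * y)" "x * (W - y\<^sup>2) < y * (Z - x * y)"
      using False by (simp_all add: algebra_simps power2_eq_square)
    then have "(y * (X - x\<^sup>2)) * (x * (W - y\<^sup>2)) < (x * (Z - x * y)) * (y * (Z - x * y))"
      by (rule mult_strict_mono) (use pos in simp_all)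
    then have "x * y * ((X - x\<^sup>2) * (W - y\<^sup>2)) < x * y * (Z - x * y)\<^sup>2"
      by (simp add: algebra_simps power2_eq_square)
    then show False using det pos by simp
  qed
  then have "represented W Z X y x"
    using represented_positive_correlation_aux[of y x Z X W] assms
    by (simp add: mult.commute)
  then show ?thesis by (rule represented_swap)
qed

section \<open>The dual cone\<close>

text \<open>The factors 2 are those of \<open>qpoly\<close>, so evaluation at a point (x, y) is the
  functional with arguments x^2, x y, y^2, x, y, 1.\<close>

definition dual_cert :: "real \<Rightarrow> real \<Rightarrow> real \<Rightarrow> real \<Rightarrow> real \<Rightarrow> real \<Rightarrow> bool" where
  "dual_cert X Z W x y Y \<longleftrightarrow> (\<forall>A C B a b p t. cert A C B a b p t \<longrightarrow>
     0 \<le> A * X + 2 * C * Z + B * W + 2 * a * x + 2 * b * y + p * Y)"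

section \<open>The certificate cone and the inequalities that explicit certificates impose on
  functionals\<close>

lemma cert_add:
  assumes "cert A C B a b p t" "cert A' C' B' a' b' p' t'"
  shows "cert (A + A') (C + C') (B + B') (a + a') (b + b') (p + p') (\<lambda>i. t i + t' i)"
proof -
  have e: "p + p' - (t 11 + t' 11) - (t 19 + t' 19) = (p - t 11 - t 19) + (p' - t' 11 - t' 19)"
    "a + a' - (t 1 + t' 1) / 2 - (t 8 + t' 8) - (t 12 + t' 12) / 2
      = (a - t 1 / 2 - t 8 - t 12 / 2) + (a' - t' 1 / 2 - t' 8 - t' 12 / 2)"
    "b + b' - (t 3 + t' 3) / 2 - (t 4 + t' 4) / 2 - (t 16 + t' 16)
      = (b - t 3 / 2 - t 4 / 2 - t 16) + (b' - t' 3 / 2 - t' 4 / 2 - t' 16)"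
    "A + A' - (t 6 + t' 6) = (A - t 6) + (A' - t' 6)"
    "B + B' - (t 14 + t' 14) = (B - t 14) + (B' - t' 14)"
    "C + C' - (t 2 + t' 2) - (t 5 + t' 5) - (t 13 + t' 13)
       - 1 / 2 * (t 9 + t' 9 - (t 11 + t' 11) + (t 17 + t' 17) - (t 19 + t' 19))
     = (C - t 2 - t 5 - t 13 - 1 / 2 * (t 9 - t 11 + t 17 - t 19))
       + (C' - t' 2 - t' 5 - t' 13 - 1 / 2 * (t' 9 - t' 11 + t' 17 - t' 19))"
    "2 * (t 8 + t' 8 - (t 7 + t' 7)) = 2 * (t 8 - t 7) + 2 * (t' 8 - t' 7)"
    "2 * (t 16 + t' 16 - (t 15 + t' 15)) = 2 * (t 16 - t 15) + 2 * (t' 16 - t' 15)"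
    by (simp_all add: algebra_simps add_divide_distrib)
  show ?thesis
    unfolding cert_def e using assms unfolding cert_def by (blast intro: psd2_add psd3_add)
qed

lemma cert_scale:
  assumes "0 \<le> k" "cert A C B a b p t"
  shows "cert (k * A) (k * C) (k * B) (k * a) (k * b) (k * p) (\<lambda>i. k * t i)"
proof -
  have e: "k * p - k * t 11 - k * t 19 = k * (p - t 11 - t 19)"
    "k * a - k * t 1 / 2 - k * t 8 - k * t 12 / 2 = k * (a - t 1 / 2 - t 8 - t 12 / 2)"
    "k * b - k * t 3 / 2 - k * t 4 / 2 - k * t 16 = k * (b - t 3 / 2 - t 4 / 2 - t 16)"
    "k * A - k * t 6 = k * (A - t 6)" "k * B - k * t 14 = k * (B - t 14)"
    "k * C - k * t 2 - k * t 5 - k * t 13 - 1 / 2 * (k * t 9 - k * t 11 + k * t 17 - k * t 19)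
     = k * (C - t 2 - t 5 - t 13 - 1 / 2 * (t 9 - t 11 + t 17 - t 19))"
    "2 * (k * t 8 - k * t 7) = k * (2 * (t 8 - t 7))"
    "2 * (k * t 16 - k * t 15) = k * (2 * (t 16 - t 15))"
    by (simp_all add: algebra_simps)
  show ?thesis
    unfolding cert_def e using assms unfolding cert_def by (blast intro: psd2_scale psd3_scale)
qed

lemma cert_zero: "cert 0 0 0 0 0 0 (\<lambda>_. 0)"
  by (simp add: cert_def psd2_zero psd3_zero)

text \<open>The functional applied to the square (u x1 + v x2 + w)^2, which is certified by the
  first matrix alone.\<close>

lemma dual_cert_square:
  assumes "dual_cert X Z W x y Y"
  shows "0 \<le> u\<^sup>2 * X + 2 * (u * v) * Z + v\<^sup>2 * W + 2 * (w * u) * x + 2 * (w * v) * y + w\<^sup>2 * Y"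
proof -
  have "cert (u\<^sup>2) (u * v) (v\<^sup>2) (w * u) (w * v) (w\<^sup>2) (\<lambda>_. 0)"
    using psd3_rank_one[of w u v] by (simp add: cert_def psd2_zero psd3_zero)
  then show ?thesis using assms unfolding dual_cert_def by blast
qed

text \<open>A rank-one second matrix certifies x1 (u + v x2)^2 + v^2 x2 (1 - x1 x2), in which the
  cubic terms cancel.\<close>

lemma dual_cert_weights:
  assumes "dual_cert X Z W x y Y"
  shows "0 \<le> u\<^sup>2 * x + 2 * (u * v) * Z + v\<^sup>2 * y"
proof -
  define t where "t = (\<lambda>_::nat. 0::real)(1 := u\<^sup>2, 2 := u * v, 3 := v\<^sup>2)"
  have "cert 0 (u * v) 0 (u\<^sup>2 / 2) (v\<^sup>2 / 2) 0 t"
    using psd2_rank_one[of 1 u v] by (simp add: t_def cert_def psd2_zero psd3_zero)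
  then have "0 \<le> 0 * X + 2 * (u * v) * Z + 0 * W + 2 * (u\<^sup>2 / 2) * x + 2 * (v\<^sup>2 / 2) * y + 0 * Y"
    using assms unfolding dual_cert_def by blast
  then show ?thesis by simp
qed

text \<open>The diagonal entries t9 and t11 certify x1 x2 and 1 - x1 x2.\<close>

lemma dual_cert_product:
  assumes "dual_cert X Z W x y Y"
  shows "0 \<le> Z" "Z \<le> Y"
proof -
  have "cert 0 (1 / 2) 0 0 0 0 ((\<lambda>_. 0)(9 := 1))"
    using psd3_rank_one[of 0 1 0] by (simp add: cert_def psd2_zero psd3_zero)
  then have "0 \<le> 0 * X + 2 * (1 / 2) * Z + 0 * W + 2 * 0 * x + 2 * 0 * y + 0 * Y"
    using assms unfolding dual_cert_def by blast
  then show "0 \<le> Z" by simp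
  have "cert 0 (- 1 / 2) 0 0 0 1 ((\<lambda>_. 0)(11 := 1))"
    using psd3_rank_one[of 0 0 1] by (simp add: cert_def psd2_zero psd3_zero)
  then have "0 \<le> 0 * X + 2 * (- 1 / 2) * Z + 0 * W + 2 * 0 * x + 2 * 0 * y + 1 * Y"
    using assms unfolding dual_cert_def by blast
  then show "Z \<le> Y" by simp
qed

text \<open>The parameters come from the quadratic \<open>(x\<^sub>1 - \<beta>)\<^sup>2\<close> on the hyperbola and \<open>(x\<^sub>1 - \<alpha>)\<^sup>2\<close> on the axis,
  so that it vanishes at \<open>(\<alpha>, 0)\<close> and \<open>(\<beta>, 1 / \<beta>)\<close>.\<close>

lemma dual_cert_slope:
  assumes d: "dual_cert X Z W x y Y" and le: "\<alpha> \<le> \<beta>"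
  shows "0 \<le> X - 2 * \<alpha> * x + \<alpha>\<^sup>2 * Y + (\<beta>\<^sup>2 - \<alpha>\<^sup>2) * Z + 2 * (\<beta> - \<alpha>) * (\<beta>\<^sup>2 * y - 2 * \<beta> * Z)"
    and "0 \<le> W - 2 * \<alpha> * y + \<alpha>\<^sup>2 * Y + (\<beta>\<^sup>2 - \<alpha>\<^sup>2) * Z + 2 * (\<beta> - \<alpha>) * (\<beta>\<^sup>2 * x - 2 * \<beta> * Z)"
proof -
  \<comment> \<open>With t7 = -\<beta> and t8 = -\<alpha> the last entry of the third matrix must be
    \<open>s\<close>. Completing it to rank one yields the term s x2 (x1 - \<beta>)^2, which also
    vanishes at both points.\<close>
  define s where "s = 2 * (\<beta> - \<alpha>)"
  have s: "0 \<le> s" using le by (simp add: s_def)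
  have p2: "psd2 (s * \<beta>\<^sup>2) (- (s * \<beta>)) (2 * (\<beta> - \<alpha>))"
    using psd2_rank_one[OF s, of \<beta> "-1"] by (simp add: s_def)
  have p3: "psd3 1 (- \<beta>) (- \<alpha>) (\<beta>\<^sup>2) (\<alpha> * \<beta>) (\<alpha>\<^sup>2)"
    using psd3_rank_one[of 1 "- \<beta>" "- \<alpha>"] by (simp add: mult.commute)
  define t where "t = (\<lambda>_::nat. 0::real)(4 := s * \<beta>\<^sup>2, 5 := - (s * \<beta>), 6 := 1, 7 := - \<beta>, 8 := - \<alpha>,
    9 := \<beta>\<^sup>2, 10 := \<alpha> * \<beta>, 11 := \<alpha>\<^sup>2)"
  have "cert 1 (- (s * \<beta>) + (\<beta>\<^sup>2 - \<alpha>\<^sup>2) / 2) 0 (- \<alpha>) (s * \<beta>\<^sup>2 / 2) (\<alpha>\<^sup>2) t"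
    using p2 p3 by (simp add: t_def cert_def psd2_zero psd3_zero)
  then have "0 \<le> 1 * X + 2 * (- (s * \<beta>) + (\<beta>\<^sup>2 - \<alpha>\<^sup>2) / 2) * Z + 0 * W + 2 * (- \<alpha>) * x + 2 * (s * \<beta>\<^sup>2 / 2) * y + \<alpha>\<^sup>2 * Y"
    using d unfolding dual_cert_def by blast
  then show "0 \<le> X - 2 * \<alpha> * x + \<alpha>\<^sup>2 * Y + (\<beta>\<^sup>2 - \<alpha>\<^sup>2) * Z + 2 * (\<beta> - \<alpha>) * (\<beta>\<^sup>2 * y - 2 * \<beta> * Z)"
    unfolding s_def by (simp add: algebra_simps diff_divide_distrib add_divide_distrib)
  \<comment> \<open>The same construction with the two coordinates exchanged.\<close>
  define t' where "t' = (\<lambda>_::nat. 0::real)(12 := s * \<beta>\<^sup>2, 13 := - (s * \<beta>), 14 := 1, 15 := - \<beta>, 16 := - \<alpha>,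
    17 := \<beta>\<^sup>2, 18 := \<alpha> * \<beta>, 19 := \<alpha>\<^sup>2)"
  have "cert 0 (- (s * \<beta>) + (\<beta>\<^sup>2 - \<alpha>\<^sup>2) / 2) 1 (s * \<beta>\<^sup>2 / 2) (- \<alpha>) (\<alpha>\<^sup>2) t'"
    using p2 p3 by (simp add: t'_def cert_def psd2_zero psd3_zero)
  then have "0 \<le> 0 * X + 2 * (- (s * \<beta>) + (\<beta>\<^sup>2 - \<alpha>\<^sup>2) / 2) * Z + 1 * W + 2 * (s * \<beta>\<^sup>2 / 2) * x + 2 * (- \<alpha>) * y + \<alpha>\<^sup>2 * Y"
    using d unfolding dual_cert_def by blast
  then show "0 \<le> W - 2 * \<alpha> * y + \<alpha>\<^sup>2 * Y + (\<beta>\<^sup>2 - \<alpha>\<^sup>2) * Z + 2 * (\<beta> - \<alpha>) * (\<beta>\<^sup>2 * x - 2 * \<beta> * Z)"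
    unfolding s_def by (simp add: algebra_simps diff_divide_distrib add_divide_distrib)
qed

text \<open>\<beta> and \<alpha> are the first coordinates of the two atoms for the weight w = Z.
  The slope inequality for this pair comes from a quadratic vanishing at both atoms, so it compares
  \<open>X\<close> with exactly their second moment.\<close>

lemma axis_atom_second_moment:
  fixes x y Z :: real
  assumes "0 < y" "Z < 1" "x * y \<le> Z"
    and slope: "\<And>\<alpha> \<beta>. \<alpha> \<le> \<beta> \<Longrightarrow>
      0 \<le> X - 2 * \<alpha> * x + \<alpha>\<^sup>2 + (\<beta>\<^sup>2 - \<alpha>\<^sup>2) * Z + 2 * (\<beta> - \<alpha>) * (\<beta>\<^sup>2 * y - 2 * \<beta> * Z)"
  shows "Z * (Z / y)\<^sup>2 + (x - Z * (Z / y))\<^sup>2 / (1 - Z) \<le> X"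
proof -
  define \<beta> where "\<beta> = Z / y"
  define \<alpha> where "\<alpha> = (x - Z * \<beta>) / (1 - Z)"
  have x: "x = (1 - Z) * \<alpha> + Z * \<beta>" and Z: "Z = \<beta> * y"
    using assms by (simp_all add: \<alpha>_def \<beta>_def)
  have "x \<le> \<beta>"
    using assms by (simp add: \<beta>_def field_simps)
  then have "\<alpha> \<le> \<beta>"
    using assms(2) by (simp add: \<alpha>_def divide_le_eq algebra_simps)
  have "\<beta>\<^sup>2 * y - 2 * \<beta> * Z = - \<beta> * Z"
    unfolding Z by (simp add: power2_eq_square)
  then have "0 \<le> X - 2 * \<alpha> * x + \<alpha>\<^sup>2 + (\<beta>\<^sup>2 - \<alpha>\<^sup>2) * Z + 2 * (\<beta> - \<alpha>) * (- \<beta> * Z)"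
    using slope[OF \<open>\<alpha> \<le> \<beta>\<close>] by (simp only:)
  also have "\<dots> = X - (Z * \<beta>\<^sup>2 + (1 - Z) * \<alpha>\<^sup>2)"
    unfolding x by (simp add: power2_eq_square algebra_simps)
  also have "(1 - Z) * \<alpha>\<^sup>2 = (x - Z * \<beta>)\<^sup>2 / (1 - Z)"
    using assms(2) by (simp add: \<alpha>_def power2_eq_square)
  finally show ?thesis by (simp add: \<beta>_def)
qed

text \<open>The cases are the signs of the covariance Z - x y. The covariance determinant and Z^2
  \<le> x y hold throughout; only positive covariance calls for the slope inequalities.\<close>

lemma represented_of_dual_cert:
  assumes d: "dual_cert X Z W x y 1"
    and pos: "0 < x" "0 < y" "0 < Z" "Z < 1" "x\<^sup>2 < X" "y\<^sup>2 < W"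
  shows "represented X Z W x y"
proof -
  have "psd2 (X - x\<^sup>2) (Z - x * y) (W - y\<^sup>2)"
    unfolding psd2_def
  proof (intro allI)
    fix u v
    \<comment> \<open>The constant term -(u x + v y) centres the linear form, turning moments into
      covariances.\<close>
    show "0 \<le> (X - x\<^sup>2) * u\<^sup>2 + 2 * (Z - x * y) * u * v + (W - y\<^sup>2) * v\<^sup>2"
      using dual_cert_square[OF d, of u v "- (u * x + v * y)"]
      by (simp add: power2_eq_square algebra_simps)
  qed
  then have det: "(Z - x * y)\<^sup>2 \<le> (X - x\<^sup>2) * (W - y\<^sup>2)"
    using psd2_det pos by simp
  have "psd2 x Z y"
    unfolding psd2_def
  proof (intro allI)
    fix u v
    show "0 \<le> x * u\<^sup>2 + 2 * Z * u * v + y * v\<^sup>2"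
      using dual_cert_weights[OF d, of u v] by (simp add: algebra_simps)
  qed
  then have Z: "Z\<^sup>2 \<le> x * y"
    using psd2_det pos by simp
  consider "Z < x * y" | "Z = x * y" | "x * y < Z" by linarith
  then show ?thesis
  proof cases
    case 1
    then show ?thesis using represented_negative_correlation det pos by blast
  next
    case 2
    then show ?thesis using represented_uncorrelated pos by blast
  next
    case 3
    have "Z * (Z / y)\<^sup>2 + (x - Z * (Z / y))\<^sup>2 / (1 - Z) \<le> X"
      using dual_cert_slope(1)[OF d] pos 3 by (intro axis_atom_second_moment) auto
    moreover have "Z * (Z / x)\<^sup>2 + (y - Z * (Z / x))\<^sup>2 / (1 - Z) \<le> W"
      using dual_cert_slope(2)[OF d] pos 3 by (intro axis_atom_second_moment) (auto simp: mult.commute)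
    ultimately show ?thesis
      using represented_positive_correlation det pos Z 3 by blast
  qed
qed

section \<open>Perturbation of functionals to strict inequalities, and the limit\<close>

lemma dual_cert_eval:
  assumes "inF x y"
  shows "dual_cert (x\<^sup>2) (x * y) (y\<^sup>2) x y 1"
  unfolding dual_cert_def
proof (intro allI impI)
  fix A C B a b p t assume "cert A C B a b p t"
  from cert_terms_bounded(1)[OF this assms]
  show "0 \<le> A * x\<^sup>2 + 2 * C * (x * y) + B * y\<^sup>2 + 2 * a * x + 2 * b * y + p * 1"
    by (simp add: qpoly_def algebra_simps)
qed

lemma dual_cert_add:
  assumes "dual_cert X Z W x y Y" "dual_cert X' Z' W' x' y' Y'"
  shows "dual_cert (X + X') (Z + Z') (W + W') (x + x') (y + y') (Y + Y')"
  unfolding dual_cert_def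
proof (intro allI impI)
  fix A C B a b p t assume "cert A C B a b p t"
  then have "0 \<le> A * X + 2 * C * Z + B * W + 2 * a * x + 2 * b * y + p * Y"
    "0 \<le> A * X' + 2 * C * Z' + B * W' + 2 * a * x' + 2 * b * y' + p * Y'"
    using assms unfolding dual_cert_def by blast+
  then show "0 \<le> A * (X + X') + 2 * C * (Z + Z') + B * (W + W') + 2 * a * (x + x') + 2 * b * (y + y')
      + p * (Y + Y')"
    unfolding distrib_left by linarith
qed

lemma dual_cert_scale:
  assumes "0 \<le> k" "dual_cert X Z W x y Y"
  shows "dual_cert (k * X) (k * Z) (k * W) (k * x) (k * y) (k * Y)"
  unfolding dual_cert_def
proof (intro allI impI)
  fix A C B a b p t assume "cert A C B a b p t"
  then have "0 \<le> A * X + 2 * C * Z + B * W + 2 * a * x + 2 * b * y + p * Y"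
    using assms unfolding dual_cert_def by blast
  then have "0 \<le> k * (A * X + 2 * C * Z + B * W + 2 * a * x + 2 * b * y + p * Y)"
    using assms(1) by simp
  then show "0 \<le> A * (k * X) + 2 * C * (k * Z) + B * (k * W) + 2 * a * (k * x) + 2 * b * (k * y)
      + p * (k * Y)"
    by (simp add: algebra_simps)
qed

text \<open>Adding a small multiple of the evaluations at three affinely independent interior points of
  the region makes all the inequalities strict.\<close>

lemma dual_cert_perturb:
  assumes d: "dual_cert X Z W x y Y" and e: "0 < \<epsilon>"
  defines "X' \<equiv> X + \<epsilon> * (9/16)" and "Z' \<equiv> Z + \<epsilon> * (1/2)" and "W' \<equiv> W + \<epsilon> * (9/16)"
    and "x' \<equiv> x + \<epsilon> * (5/4)" and "y' \<equiv> y + \<epsilon> * (5/4)" and "Y' \<equiv> Y + \<epsilon> * 3"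
  shows "dual_cert X' Z' W' x' y' Y'" "0 < x'" "0 < y'" "0 < Z'" "Z' < Y'"
    "x'\<^sup>2 < X' * Y'" "y'\<^sup>2 < W' * Y'"
proof -
  \<comment> \<open>The three points are (1/2, 1/2), (1/4, 1/2) and (1/2, 1/4); the constants in the
    statement are the sums of their moments.\<close>
  have "dual_cert ((1/2)\<^sup>2 + ((1/4)\<^sup>2 + (1/2)\<^sup>2)) (1/2 * (1/2) + (1/4 * (1/2) + 1/2 * (1/4)))
      ((1/2)\<^sup>2 + ((1/2)\<^sup>2 + (1/4)\<^sup>2)) (1/2 + (1/4 + 1/2)) (1/2 + (1/2 + 1/4)) (1 + (1 + 1))"
    by (intro dual_cert_add dual_cert_eval) simp_all
  then have "dual_cert (9/16) (1/2) (9/16) (5/4) (5/4) 3"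
    by (simp add: power2_eq_square)
  from dual_cert_add[OF d dual_cert_scale[OF less_imp_le[OF e] this]]
  show "dual_cert X' Z' W' x' y' Y'"
    unfolding X'_def Z'_def W'_def x'_def y'_def Y'_def .
  have "0 \<le> x" "0 \<le> y" "0 \<le> Y"
    using dual_cert_weights[OF d, of 1 0] dual_cert_weights[OF d, of 0 1] dual_cert_square[OF d, of 0 0 1]
    by simp_all
  then have Y': "0 < Y'" and "0 < x'" "0 < y'"
    using e by (simp_all add: x'_def y'_def Y'_def)
  then show "0 < x'" "0 < y'" by blast+
  show "0 < Z'" "Z' < Y'"
    using dual_cert_product[OF d] e by (simp_all add: Z'_def Y'_def)
  have strict: "z'\<^sup>2 < V' * Y'"
    if sq: "\<And>u w. 0 \<le> u\<^sup>2 * V + 2 * (w * u) * z + w\<^sup>2 * Y"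
      and V': "V' = V + \<epsilon> * (9/16)" and z': "z' = z + \<epsilon> * (5/4)" for V V' z z'
  proof -
    \<comment> \<open>The perturbing moments give a positive definite form, since 9/16 * 3 >
      (5/4)^2. This is its completed square at the vector (Y', -z'), where the perturbed form equals
      Y' (V' Y' - z'^2).\<close>
    have "0 < (Y' * 5 - z' * 12)\<^sup>2 / 48 + Y'\<^sup>2 * (1/24)"
      using Y' by (simp add: add_nonneg_pos)
    also have "\<dots> = Y'\<^sup>2 * (9/16) + 2 * (- z' * Y') * (5/4) + (- z')\<^sup>2 * 3"
      by (simp add: power2_eq_square field_simps)
    finally have "0 < \<epsilon> * (Y'\<^sup>2 * (9/16) + 2 * (- z' * Y') * (5/4) + (- z')\<^sup>2 * 3)"
      using e by simp
    with sq[of Y' "- z'"]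
    have "0 < (Y'\<^sup>2 * V + 2 * (- z' * Y') * z + (- z')\<^sup>2 * Y)
      + \<epsilon> * (Y'\<^sup>2 * (9/16) + 2 * (- z' * Y') * (5/4) + (- z')\<^sup>2 * 3)"
      by simp
    also have "\<dots> = Y'\<^sup>2 * V' + 2 * (- z' * Y') * z' + z'\<^sup>2 * Y'"
      unfolding V' by (subst (4) z', subst (6) Y'_def) (simp add: algebra_simps)
    also have "\<dots> = Y' * (V' * Y' - z'\<^sup>2)"
      by (simp add: power2_eq_square algebra_simps)
    finally show ?thesis using Y' by (simp add: zero_less_mult_iff)
  qed
  show "x'\<^sup>2 < X' * Y'"
    using dual_cert_square[OF d, of _ 0] by (intro strict[of X x]) (simp_all add: X'_def x'_def)
  show "y'\<^sup>2 < W' * Y'"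
    using dual_cert_square[OF d, of 0] by (intro strict[of W y]) (simp_all add: W'_def y'_def)
qed

text \<open>Each perturbed functional, divided by its value at 1, is represented by points of the
  region and hence nonnegative on the quadratic. Letting the perturbation tend to 0 gives the
  claim.\<close>

lemma dual_cert_nonneg:
  assumes d: "dual_cert X Z W x y Y"
    and nn: "\<And>u v. inF u v \<Longrightarrow> 0 \<le> qpoly A C B a b p u v"
  shows "0 \<le> A * X + 2 * C * Z + B * W + 2 * a * x + 2 * b * y + p * Y"
proof -
  let ?L = "A * X + 2 * C * Z + B * W + 2 * a * x + 2 * b * y + p * Y"
  let ?E = "A * (9/16) + 2 * C * (1/2) + B * (9/16) + 2 * a * (5/4) + 2 * b * (5/4) + p * 3"
  have "0 \<le> ?L + \<epsilon> * ?E" if e: "0 < \<epsilon>" for \<epsilon>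
  proof -
    define X' Z' W' x' y' Y' where defs: "X' = X + \<epsilon> * (9/16)" "Z' = Z + \<epsilon> * (1/2)"
      "W' = W + \<epsilon> * (9/16)" "x' = x + \<epsilon> * (5/4)" "y' = y + \<epsilon> * (5/4)" "Y' = Y + \<epsilon> * 3"
    note P = dual_cert_perturb[OF d e, folded defs]
    have Y': "0 < Y'" using P(4,5) by simp
    have "represented (1 / Y' * X') (1 / Y' * Z') (1 / Y' * W') (1 / Y' * x') (1 / Y' * y')"
    proof (rule represented_of_dual_cert)
      show "dual_cert (1 / Y' * X') (1 / Y' * Z') (1 / Y' * W') (1 / Y' * x') (1 / Y' * y') 1"
        using dual_cert_scale[of "1 / Y'", OF _ P(1)] Y' by simp
    qed (use P Y' in \<open>simp_all add: power2_eq_square field_simps\<close>)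
    from represented_nonneg[OF this, of A C B a b p, OF nn]
    have "0 \<le> Y' * (A * (1 / Y' * X') + 2 * C * (1 / Y' * Z') + B * (1 / Y' * W')
      + 2 * a * (1 / Y' * x') + 2 * b * (1 / Y' * y') + p)"
      using Y' by simp
    also have "\<dots> = A * X' + 2 * C * Z' + B * W' + 2 * a * x' + 2 * b * y' + p * Y'"
      using Y' by (simp add: field_simps)
    also have "\<dots> = ?L + \<epsilon> * ?E"
      unfolding defs by (simp add: algebra_simps)
    finally show ?thesis .
  qed
  then have "0 \<le> ?L + \<epsilon>" if "0 < \<epsilon>" for \<epsilon>
  proof -
    \<comment> \<open>Scaling by |E| + 1 keeps the perturbation term below \<epsilon> and avoids
      division by 0.\<close>
    have "\<epsilon> / (\<bar>?E\<bar> + 1) * ?E \<le> \<epsilon> / (\<bar>?E\<bar> + 1) * (\<bar>?E\<bar> + 1)"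
      using that by (intro mult_left_mono) auto
    also have "\<dots> = \<epsilon>" by simp
    finally show ?thesis
      using \<open>\<And>\<epsilon>. 0 < \<epsilon> \<Longrightarrow> 0 \<le> ?L + \<epsilon> * ?E\<close>[of "\<epsilon> / (\<bar>?E\<bar> + 1)"] that by simp
  qed
  then show ?thesis
    by (rule field_le_epsilon)
qed

section \<open>Closedness of the certificate cone and separation\<close>

lemma tendsto_cert:
  assumes c: "\<And>n. cert (A n) (C n) (B n) (a n) (b n) (p n) (t n)"
    and lim: "A \<longlonglongrightarrow> A'" "C \<longlonglongrightarrow> C'" "B \<longlonglongrightarrow> B'" "a \<longlonglongrightarrow> a'" "b \<longlonglongrightarrow> b'" "p \<longlonglongrightarrow> p'"
    and t: "\<And>i. 1 \<le> i \<Longrightarrow> i \<le> 19 \<Longrightarrow> (\<lambda>n. t n i) \<longlonglongrightarrow> t' i"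
  shows "cert A' C' B' a' b' p' t'"
proof -
  have psd: "\<forall>n. psd3 (p n - t n 11 - t n 19) (a n - t n 1 / 2 - t n 8 - t n 12 / 2) (b n - t n 3 / 2 - t n 4 / 2 - t n 16)
      (A n - t n 6) (C n - t n 2 - t n 5 - t n 13 - 1 / 2 * (t n 9 - t n 11 + t n 17 - t n 19)) (B n - t n 14)"
    "\<forall>n. psd2 (t n 1) (t n 2) (t n 3)" "\<forall>n. psd2 (t n 4) (t n 5) (2 * (t n 8 - t n 7))"
    "\<forall>n. psd3 (t n 6) (t n 7) (t n 8) (t n 9) (t n 10) (t n 11)"
    "\<forall>n. psd2 (t n 12) (t n 13) (2 * (t n 16 - t n 15))"
    "\<forall>n. psd3 (t n 14) (t n 15) (t n 16) (t n 17) (t n 18) (t n 19)"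
    using c unfolding cert_def by auto
  show ?thesis
    unfolding cert_def
  proof (intro conjI)
    show "psd3 (p' - t' 11 - t' 19) (a' - t' 1 / 2 - t' 8 - t' 12 / 2) (b' - t' 3 / 2 - t' 4 / 2 - t' 16)
      (A' - t' 6) (C' - t' 2 - t' 5 - t' 13 - 1 / 2 * (t' 9 - t' 11 + t' 17 - t' 19)) (B' - t' 14)"
      by (rule tendsto_psd3, rule psd(1)) (intro tendsto_intros lim t; simp)+
    show "psd2 (t' 1) (t' 2) (t' 3)"
      by (rule tendsto_psd2, rule psd(2)) (intro t; simp)+
    show "psd2 (t' 4) (t' 5) (2 * (t' 8 - t' 7))"
      by (rule tendsto_psd2, rule psd(3)) (intro tendsto_intros t; simp)+
    show "psd3 (t' 6) (t' 7) (t' 8) (t' 9) (t' 10) (t' 11)"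
      by (rule tendsto_psd3, rule psd(4)) (intro t; simp)+
    show "psd2 (t' 12) (t' 13) (2 * (t' 16 - t' 15))"
      by (rule tendsto_psd2, rule psd(5)) (intro tendsto_intros t; simp)+
    show "psd3 (t' 14) (t' 15) (t' 16) (t' 17) (t' 18) (t' 19)"
      by (rule tendsto_psd3, rule psd(6)) (intro t; simp)+
  qed
qed

text \<open>Coefficients are collected in a Euclidean space, where a closed convex set can be
  separated from a point.\<close>

definition cert_set :: "(real \<times> real \<times> real \<times> real \<times> real \<times> real) set" where
  "cert_set = {(A, C, B, a, b, p) | A C B a b p. \<exists>t. cert A C B a b p t}"

lemma scaleR_mem_cert_set:
  assumes "0 \<le> k" "z \<in> cert_set"
  shows "k *\<^sub>R z \<in> cert_set"
proof -
  obtain A C B a b p t where z: "z = (A, C, B, a, b, p)" and "cert A C B a b p t"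
    using assms(2) unfolding cert_set_def by blast
  from cert_scale[OF assms(1) this(2)] show ?thesis
    unfolding cert_set_def z by auto
qed

lemma add_mem_cert_set:
  assumes "z \<in> cert_set" "z' \<in> cert_set"
  shows "z + z' \<in> cert_set"
proof -
  obtain A C B a b p t where z: "z = (A, C, B, a, b, p)" and c: "cert A C B a b p t"
    using assms(1) unfolding cert_set_def by blast
  obtain A' C' B' a' b' p' t' where z': "z' = (A', C', B', a', b', p')" and c': "cert A' C' B' a' b' p' t'"
    using assms(2) unfolding cert_set_def by blast
  from cert_add[OF c c'] show ?thesis
    unfolding cert_set_def z z' by auto
qed

lemma convex_cert_set: "convex cert_set"
  by (intro convexI add_mem_cert_set scaleR_mem_cert_set)

lemma norm_fst_component_le: "norm (fst z) \<le> norm z"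
  using norm_fst_le[of "fst z" "snd z"] by simp

lemma norm_snd_component_le: "norm (snd z) \<le> norm z"
  using norm_snd_le[of "snd z" "fst z"] by simp

text \<open>A convergent sequence has bounded coefficients, hence bounded parameters. A subsequence
  of the parameters converges, and semidefiniteness passes to the limit.\<close>

lemma closed_cert_set: "closed cert_set"
  unfolding closed_sequential_limits
proof (intro allI impI)
  fix z :: "nat \<Rightarrow> real \<times> real \<times> real \<times> real \<times> real \<times> real" and l
  assume "(\<forall>n. z n \<in> cert_set) \<and> z \<longlonglongrightarrow> l"
  then have z: "\<And>n. z n \<in> cert_set" and lim: "z \<longlonglongrightarrow> l" by auto
  define A C B a b p where defs: "A = (\<lambda>n. fst (z n))" "C = (\<lambda>n. fst (snd (z n)))"
    "B = (\<lambda>n. fst (snd (snd (z n))))" "a = (\<lambda>n. fst (snd (snd (snd (z n)))))"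
    "b = (\<lambda>n. fst (snd (snd (snd (snd (z n))))))" "p = (\<lambda>n. snd (snd (snd (snd (snd (z n))))))"
  have "\<exists>t. cert (A n) (C n) (B n) (a n) (b n) (p n) t" for n
    using z[of n] unfolding cert_set_def defs by auto
  then obtain t where t: "\<And>n. cert (A n) (C n) (B n) (a n) (b n) (p n) (t n)"
    by metis
  obtain N where N: "\<And>n. norm (z n) \<le> N"
    using convergent_imp_bounded[OF lim] unfolding bounded_iff by auto
  have le: "\<bar>A n\<bar> \<le> N" "\<bar>C n\<bar> \<le> N" "\<bar>B n\<bar> \<le> N" "\<bar>a n\<bar> \<le> N" "\<bar>b n\<bar> \<le> N" "\<bar>p n\<bar> \<le> N" for n
    unfolding defs real_norm_def[symmetric]
    by (intro order_trans[OF norm_fst_component_le] order_trans[OF norm_snd_component_le] N)+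
  have "\<bar>t n i\<bar> \<le> 10^6 * N" if "1 \<le> i" "i \<le> 19" for n i
    using cert_parameters_bounded[OF t le that] .
  then have "bounded ((\<lambda>s. s i) ` range t)" if "i \<in> {1..19}" for i
    using that unfolding bounded_iff by (intro exI[of _ "10^6 * N"]) auto
  \<comment> \<open>Bolzano-Weierstrass for the finitely many coordinates 1 to 19 of parameter
    functions on all naturals.\<close>
  then have "\<exists>t' r. strict_mono (r :: nat \<Rightarrow> nat) \<and>
      (\<forall>\<epsilon>>0. \<forall>\<^sub>F n in sequentially. \<forall>i\<in>{1..19}. dist (t (r n) i) (t' i) < \<epsilon>)"
    by (intro compact_lemma_general[of "{1..19}" "\<lambda>s i. s i" t "\<lambda>s. s", rule_format]) auto
  then obtain t' and r :: "nat \<Rightarrow> nat" where r: "strict_mono r" and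
    t': "\<And>\<epsilon>. 0 < \<epsilon> \<Longrightarrow> \<forall>\<^sub>F n in sequentially. \<forall>i\<in>{1..19}. dist (t (r n) i) (t' i) < \<epsilon>"
    by blast
  have t_lim: "(\<lambda>n. t (r n) i) \<longlonglongrightarrow> t' i" if "1 \<le> i" "i \<le> 19" for i
  proof (rule tendstoI)
    fix \<epsilon> :: real assume "0 < \<epsilon>"
    from t'[OF this] show "\<forall>\<^sub>F n in sequentially. dist (t (r n) i) (t' i) < \<epsilon>"
      by eventually_elim (use that in auto)
  qed
  have lim': "(\<lambda>n. z (r n)) \<longlonglongrightarrow> l"
    using LIMSEQ_subseq_LIMSEQ[OF lim r] by (simp add: o_def)
  have coeff_lim: "(\<lambda>n. A (r n)) \<longlonglongrightarrow> fst l" "(\<lambda>n. C (r n)) \<longlonglongrightarrow> fst (snd l)"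
    "(\<lambda>n. B (r n)) \<longlonglongrightarrow> fst (snd (snd l))" "(\<lambda>n. a (r n)) \<longlonglongrightarrow> fst (snd (snd (snd l)))"
    "(\<lambda>n. b (r n)) \<longlonglongrightarrow> fst (snd (snd (snd (snd l))))"
    "(\<lambda>n. p (r n)) \<longlonglongrightarrow> snd (snd (snd (snd (snd l))))"
    unfolding defs by (intro tendsto_fst tendsto_snd lim')+
  have "cert (fst l) (fst (snd l)) (fst (snd (snd l))) (fst (snd (snd (snd l))))
      (fst (snd (snd (snd (snd l))))) (snd (snd (snd (snd (snd l))))) t'"
    by (rule tendsto_cert[OF _ coeff_lim, of "\<lambda>n. t (r n)"]) (rule t, rule t_lim)
  then show "l \<in> cert_set"
    unfolding cert_set_def by (cases l) (simp, blast)
qed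

text \<open>A hyperplane strictly separates the point from the closed convex set; because the set is
  a cone, the separating functional is nonnegative on it.\<close>

lemma cert_separation:
  assumes "\<nexists>t. cert A C B a b p t"
  obtains X Z W x y Y where "dual_cert X Z W x y Y"
    and "A * X + 2 * C * Z + B * W + 2 * a * x + 2 * b * y + p * Y < 0"
proof -
  have "(A, C, B, a, b, p) \<notin> cert_set"
    using assms unfolding cert_set_def by auto
  from separating_hyperplane_closed_point[OF convex_cert_set closed_cert_set this]
  obtain n \<beta> where n: "n \<bullet> (A, C, B, a, b, p) < \<beta>" "\<And>z. z \<in> cert_set \<Longrightarrow> \<beta> < n \<bullet> z"
    by blast
  have "(0, 0, 0, 0, 0, 0) \<in> cert_set"
    using cert_zero unfolding cert_set_def by blast
  from n(2)[OF this] have "\<beta> < 0" by (simp add: inner_prod_def)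
  have nonneg: "0 \<le> n \<bullet> z" if "z \<in> cert_set" for z
  proof (rule ccontr)
    assume "\<not> 0 \<le> n \<bullet> z"
    \<comment> \<open>Rescaling \<open>z\<close> by this factor stays in the cone and gives the
      value \<beta>, which the strict separation excludes.\<close>
    then have "0 \<le> \<beta> / (n \<bullet> z)" "\<beta> / (n \<bullet> z) * (n \<bullet> z) = \<beta>"
      using \<open>\<beta> < 0\<close> by (simp_all add: divide_nonpos_neg)
    then show False
      using n(2)[OF scaleR_mem_cert_set[OF _ that], of "\<beta> / (n \<bullet> z)"] by simp
  qed
  obtain X Z W x y Y where n_eq: "n = (X, Z, W, x, y, Y)" by (cases n)
  show thesis
  proof (rule that)
    \<comment> \<open>Halving three components of the normal vector absorbs the factors 2 in
      \<open>dual_cert\<close>.\<close>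
    show "dual_cert X (Z / 2) W (x / 2) (y / 2) Y"
      unfolding dual_cert_def
    proof (intro allI impI)
      fix A C B a b p t assume "cert A C B a b p t"
      then have "(A, C, B, a, b, p) \<in> cert_set" unfolding cert_set_def by blast
      from nonneg[OF this]
      show "0 \<le> A * X + 2 * C * (Z / 2) + B * W + 2 * a * (x / 2) + 2 * b * (y / 2) + p * Y"
        by (simp add: n_eq inner_prod_def algebra_simps)
    qed
    show "A * X + 2 * C * (Z / 2) + B * W + 2 * a * (x / 2) + 2 * b * (y / 2) + p * Y < 0"
      using n(1) \<open>\<beta> < 0\<close> by (simp add: n_eq inner_prod_def algebra_simps)
  qed
qed

lemma cert_iff_nonneg:
  "(\<exists>t. cert A C B a b p t) \<longleftrightarrow> (\<forall>x y. inF x y \<longrightarrow> 0 \<le> qpoly A C B a b p x y)"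
proof
  assume "\<exists>t. cert A C B a b p t"
  then show "\<forall>x y. inF x y \<longrightarrow> 0 \<le> qpoly A C B a b p x y"
    using cert_terms_bounded(1) by blast
next
  assume nn: "\<forall>x y. inF x y \<longrightarrow> 0 \<le> qpoly A C B a b p x y"
  show "\<exists>t. cert A C B a b p t"
  proof (rule ccontr)
    assume "\<nexists>t. cert A C B a b p t"
    then obtain X Z W x y Y where d: "dual_cert X Z W x y Y"
      and neg: "A * X + 2 * C * Z + B * W + 2 * a * x + 2 * b * y + p * Y < 0"
      by (rule cert_separation)
    have "0 \<le> A * X + 2 * C * Z + B * W + 2 * a * x + 2 * b * y + p * Y"
      by (rule dual_cert_nonneg[OF d]) (use nn in blast)
    with neg show False by simp
  qed
qed

theorem theorem3p3:
  fixes R :: "real^2^2" and r :: "real^2" and p :: real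
  assumes "transpose R = R"
  shows "(q R r p \<in> nonneg_cone F \<longleftrightarrow> (\<exists>t :: nat \<Rightarrow> real. all_psd R r p t)) \<and>
         (q R r p \<in> nonneg_cone F \<longleftrightarrow>
           (\<exists>t :: nat \<Rightarrow> real. all_psd R r p t \<and>
              (\<forall>x :: real^2. q R r p x = certificate R r p t x)))"
proof -
  have "q R r p \<in> nonneg_cone F \<longleftrightarrow>
      (\<forall>x y. inF x y \<longrightarrow> 0 \<le> qpoly (R$1$1) (R$1$2) (R$2$2) (r$1) (r$2) p x y)"
    unfolding mem_nonneg_cone_iff[OF assms] q_eq_qpoly[OF assms] F_def
    by (auto, metis vector_2)
  then have "q R r p \<in> nonneg_cone F \<longleftrightarrow> (\<exists>t. all_psd R r p t)"
    unfolding all_psd_iff_cert cert_iff_nonneg .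
  \<comment> \<open>The polynomial identity holds for every choice of parameters, so both
    existential statements agree.\<close>
  then show ?thesis
    using q_eq_certificate[OF assms] by blast
qed

end
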